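(* Let $W_n\in F(a,b)$ be a random freely reduced word of length $n$, generated by the standard nonbacktracking Markov chain. Then for every $D>0$, \[ \deg f_{W_n}= \frac{5n}{6}+O_D(\sqrt{n\log n}) \] with probability at least $1-O_D(n^{-D})$. The same estimate holds when $W_n$ is replaced by a uniformly random cyclically reduced word of length $n$ in $F(a,b)$.
   Context: $F(a,b)$ is the free group on $a,b$. For $w\in F(a,b)$ and $A,B\in \mathrm{SL}(2,\mathbb C)$, $w(A,B)$ denotes the image of $w$ under $a\mapsto A$, $b\mapsto B$. The trace polynomial $f_w(x,y,z)\in\mathbb Z[x,y,z]$ is the unique polynomial such that $\mathrm{Tr}(w(A,B))=f_w(\mathrm{Tr}A,\mathrm{Tr}B,\mathrm{Tr}(AB))$ for all $A,B\in \mathrm{SL}(2,\mathbb C)$ (its existence and uniqueness are classical). $\deg$ is total degree. Standard nonbacktracking Markov chain: the first letter is uniform on $\{a,a^{-1},b,b^{-1}\}$ and each next letter is chosen uniformly among the three letters which are not the inverse of the current one. A word is cyclically reduced if it is freely reduced and its last letter is not the inverse of its first letter. The assertion "$X_n=O_D(\sqrt{n\log n})$ with probability at least $1-O_D(n^{-D})$" means: there exist constants $C_D,C'_D>0$, depending on $D$ but not on $n$, such that for all sufficiently large $n$, $\Pr(|X_n|\le C_D\sqrt{n\log n})\ge 1-C'_Dn^{-D}$. *)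

theory Defs
  imports "HOL-Probability.Probability" "HOL-Library.Poly_Mapping"
begin

text \<open>
  Elements of the free group \<open>F(a,b)\<close> are represented by words in the letters
  \<open>a, a\<^sup>-\<^sup>1, b, b\<^sup>-\<^sup>1\<close>; each element has exactly one freely reduced representative.
\<close>

datatype letter = LA | LA_inv | LB | LB_inv

type_synonym word = "letter list"

fun inv_letter :: "letter \<Rightarrow> letter" where
  "inv_letter LA = LA_inv"
| "inv_letter LA_inv = LA"
| "inv_letter LB = LB_inv"
| "inv_letter LB_inv = LB"

definition freely_reduced :: "word \<Rightarrow> bool" where
  "freely_reduced w \<longleftrightarrow> successively (\<lambda>l m. m \<noteq> inv_letter l) w"

definition cyclically_reduced :: "word \<Rightarrow> bool" where
  "cyclically_reduced w \<longleftrightarrow>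
     freely_reduced w \<and> (w \<noteq> [] \<longrightarrow> last w \<noteq> inv_letter (hd w))"

definition SL2C :: "(complex^2^2) set" where
  "SL2C = {A. det A = 1}"

fun letter_eval :: "complex^2^2 \<Rightarrow> complex^2^2 \<Rightarrow> letter \<Rightarrow> complex^2^2" where
  "letter_eval A B LA = A"
| "letter_eval A B LA_inv = matrix_inv A"
| "letter_eval A B LB = B"
| "letter_eval A B LB_inv = matrix_inv B"

primrec word_eval :: "complex^2^2 \<Rightarrow> complex^2^2 \<Rightarrow> word \<Rightarrow> complex^2^2" where
  "word_eval A B [] = mat 1"
| "word_eval A B (l # w) = letter_eval A B l ** word_eval A B w"

text \<open>
  On \<open>SL(2,\<complex>)\<close> the evaluation is multiplicative and insensitive to free
  cancellation, so it is the homomorphism on \<open>F(a,b)\<close> with \<open>a \<mapsto> A\<close>, \<open>b \<mapsto> B\<close>.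
\<close>

lemma word_eval_append: "word_eval A B (u @ v) = word_eval A B u ** word_eval A B v"
  by (induction u) (simp_all add: matrix_mul_assoc)

lemma matrix_inv_cancel:
  assumes "invertible A"
  shows "A ** matrix_inv A = mat 1" "matrix_inv A ** A = mat 1"
  using someI_ex[OF assms[unfolded invertible_def]]
  by (simp_all add: matrix_inv_def)

lemma word_eval_cancel:
  assumes "A \<in> SL2C" "B \<in> SL2C"
  shows "word_eval A B (u @ [l, inv_letter l] @ v) = word_eval A B (u @ v)"
proof -
  have "invertible A" "invertible B"
    using assms by (simp_all add: SL2C_def invertible_det_nz)
  then have "letter_eval A B l ** letter_eval A B (inv_letter l) = mat 1"
    by (cases l) (simp_all add: matrix_inv_cancel)
  then show ?thesis
    by (simp add: word_eval_append matrix_mul_assoc [symmetric])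
      (simp add: matrix_mul_assoc)
qed

text \<open>
  \<open>\<int>[x,y,z]\<close> is the monoid algebra over exponent vectors: the coefficient of
  \<open>x\<^sup>i y\<^sup>j z\<^sup>k\<close> in \<open>f\<close> is \<open>Poly_Mapping.lookup f (i, j, k)\<close>.
\<close>

type_synonym poly3 = "(nat \<times> nat \<times> nat) \<Rightarrow>\<^sub>0 int"

definition eval3 :: "poly3 \<Rightarrow> complex \<Rightarrow> complex \<Rightarrow> complex \<Rightarrow> complex" where
  "eval3 f x y z =
     (\<Sum>(i, j, k)\<in>Poly_Mapping.keys f. of_int (Poly_Mapping.lookup f (i, j, k))
        * x ^ i * y ^ j * z ^ k)"

text \<open>The zero polynomial gets degree \<open>0\<close>; it is never a trace polynomial.\<close>

definition total_degree :: "poly3 \<Rightarrow> nat" where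
  "total_degree f = Max (insert 0 ((\<lambda>(i, j, k). i + j + k) ` Poly_Mapping.keys f))"

definition trace_poly :: "word \<Rightarrow> poly3" where
  "trace_poly w = (THE f. \<forall>A\<in>SL2C. \<forall>B\<in>SL2C.
     trace (word_eval A B w) = eval3 f (trace A) (trace B) (trace (A ** B)))"

primrec nonbacktracking_from :: "letter \<Rightarrow> nat \<Rightarrow> word pmf" where
  "nonbacktracking_from l 0 = return_pmf []"
| "nonbacktracking_from l (Suc n) =
     bind_pmf (pmf_of_set (UNIV - {inv_letter l}))
       (\<lambda>m. map_pmf ((#) m) (nonbacktracking_from m n))"

fun nonbacktracking_word :: "nat \<Rightarrow> word pmf" where
  "nonbacktracking_word 0 = return_pmf []"
| "nonbacktracking_word (Suc n) =
     bind_pmf (pmf_of_set UNIV) (\<lambda>l. map_pmf ((#) l) (nonbacktracking_from l n))"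

definition uniform_cyclically_reduced :: "nat \<Rightarrow> word pmf" where
  "uniform_cyclically_reduced n = pmf_of_set {w. length w = n \<and> cyclically_reduced w}"

end

theory Submission imports Defs "HOL-Computational_Algebra.Polynomial" begin

text \<open>
  Let \<open>x, y, z\<close> grow linearly in a parameter \<open>t\<close>. For a suitable pair \<open>A, B\<close> with these traces, the
  matrices \<open>A\<^sup>\<plusminus>\<^sup>1\<close>, \<open>B\<^sup>\<plusminus>\<^sup>1\<close> and \<open>(AB)\<^sup>\<plusminus>\<^sup>1\<close> are all asymptotic to \<open>t\<close> times rank-one matrices, and the
  row and column vectors meeting at any other admissible junction are not orthogonal. Hence for a
  cyclically reduced word of length \<open>n\<close> the trace grows exactly like \<open>t\<^sup>d\<close>, where \<open>n - d\<close> is the number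
  of cyclic occurrences of \<open>ab\<close> and \<open>b\<^sup>-\<^sup>1a\<^sup>-\<^sup>1\<close>; for generic limit directions \<open>d\<close> is the degree of
  the trace polynomial.

  Splitting the letters into \<open>{a, b\<^sup>-\<^sup>1}\<close> and \<open>{a\<^sup>-\<^sup>1, b}\<close>, these junctions are the passages from the
  first class to the second, so up to a bounded error their number is half the number of class
  changes. The latter is binomial with parameter \<open>1/3\<close>, and Hoeffding's inequality applies. A
  random reduced word is conjugate to its cyclic core by a word of length \<open>O(log n)\<close> outside an
  event of probability \<open>O(n\<^bsup>-D\<^esup>)\<close>, and a positive proportion of the reduced words is cyclically
  reduced.
\<close>

section \<open>Degree and growth of polynomials\<close>

lemma eval3_superset:
  assumes "finite S" "Poly_Mapping.keys f \<subseteq> S"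
  shows "eval3 f x y z =
    (\<Sum>(i, j, k)\<in>S. of_int (Poly_Mapping.lookup f (i, j, k)) * x ^ i * y ^ j * z ^ k)"
  unfolding eval3_def
  by (rule sum.mono_neutral_left) (use assms in \<open>auto simp: in_keys_iff\<close>)

lemma eval3_add: "eval3 (f + g) x y z = eval3 f x y z + eval3 g x y z"
proof -
  let ?S = "Poly_Mapping.keys f \<union> Poly_Mapping.keys g"
  have "Poly_Mapping.keys (f + g) \<subseteq> ?S"
    by (rule Poly_Mapping.keys_add)
  then show ?thesis
    by (simp add: eval3_superset[of ?S] lookup_add algebra_simps sum.distrib[symmetric] case_prod_unfold)
qed

lemma eval3_0 [simp]: "eval3 0 x y z = 0"
  by (simp add: eval3_def)

lemma eval3_uminus: "eval3 (- f) x y z = - eval3 f x y z"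
  using eval3_add[of f "- f" x y z] by (simp add: eq_neg_iff_add_eq_0 add.commute)

lemma eval3_minus: "eval3 (f - g) x y z = eval3 f x y z - eval3 g x y z"
  using eval3_add[of f "- g" x y z] by (simp add: eval3_uminus)

lemma eval3_single:
  "eval3 (Poly_Mapping.single (i, j, k) c) x y z = of_int c * x ^ i * y ^ j * z ^ k"
  by (subst eval3_superset[of "{(i, j, k)}"]) auto

lemma eval3_sum: "eval3 (sum F S) x y z = (\<Sum>s\<in>S. eval3 (F s) x y z)"
  by (induction S rule: infinite_finite_induct) (simp_all add: eval3_add)

text \<open>Shifting all exponent vectors by \<open>(a, b, c)\<close> gives \<open>g\<close>. The
  existential form suffices to close \<open>eval3_funs\<close> under multiplication by a
  variable.\<close>

lemma eval3_mult_monom_ex: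
  "\<exists>g. \<forall>x y z. eval3 g x y z = x ^ a * y ^ b * z ^ c * eval3 f x y z"
proof (intro exI allI)
  fix x y z :: complex
  show "eval3 (\<Sum>(i, j, k)\<in>Poly_Mapping.keys f.
      Poly_Mapping.single (i + a, j + b, k + c) (Poly_Mapping.lookup f (i, j, k))) x y z
    = x ^ a * y ^ b * z ^ c * eval3 f x y z"
    unfolding eval3_sum eval3_def[of f] sum_distrib_left
    by (rule sum.cong) (auto simp: eval3_single power_add)
qed

text \<open>Kronecker's substitution \<open>(x, y, z) = (s, s\<^sup>N, s\<^bsup>N * N\<^esup>)\<close> separates the monomials.\<close>

lemma exists_nonzero_value:
  fixes c :: "nat \<times> nat \<times> nat \<Rightarrow> complex"
  assumes "finite K" "p \<in> K" "c p \<noteq> 0"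
  shows "\<exists>x y z. x \<noteq> 0 \<and> y \<noteq> 0 \<and> z \<noteq> 0 \<and> (\<Sum>(i, j, k)\<in>K. c (i, j, k) * x ^ i * y ^ j * z ^ k) \<noteq> 0"
proof -
  \<comment> \<open>\<open>N\<close> exceeds every exponent occurring in \<open>K\<close>, so
    \<open>e\<close> reads \<open>(i, j, k)\<close> as base-\<open>N\<close> digits; injectivity
    recovers them one at a time modulo \<open>N\<close>.\<close>
  define N where "N = Suc (\<Sum>(i, j, k)\<in>K. i + j + k)"
  have bound: "i < N \<and> j < N \<and> k < N" if "(i, j, k) \<in> K" for i j k
    using member_le_sum[OF that, of "\<lambda>(i, j, k). i + j + k"] assms(1) by (simp add: N_def)
  define e where "e = (\<lambda>(i, j, k). i + N * (j + N * k))"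
  have inj: "inj_on e K"
  proof (rule inj_onI)
    fix q r assume qr: "q \<in> K" "r \<in> K" "e q = e r"
    obtain i j k i' j' k' where [simp]: "q = (i, j, k)" "r = (i', j', k')"
      by (metis prod_cases3)
    have b: "i < N" "j < N" "k < N" "i' < N" "j' < N" "k' < N"
      using bound qr by auto
    have eq: "i + N * (j + N * k) = i' + N * (j' + N * k')"
      using qr(3) by (simp add: e_def)
    have "i = i'"
      using arg_cong[OF eq, of "\<lambda>m. m mod N"] b by simp
    then have eq2: "j + N * k = j' + N * k'"
      using eq b by simp
    have "j = j'"
      using arg_cong[OF eq2, of "\<lambda>m. m mod N"] b by simp
    with eq2 b \<open>i = i'\<close> show "q = r"
      by simp
  qed
  define P where "P = (\<Sum>q\<in>K. monom (c q) (e q))"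
  have "coeff P (e p) = (\<Sum>q\<in>K. if q = p then c q else 0)"
    unfolding P_def coeff_sum coeff_monom
    by (rule sum.cong) (use inj assms(2) in \<open>auto dest: inj_onD\<close>)
  then have "P \<noteq> 0"
    using assms by auto
  \<comment> \<open>Excluding \<open>0\<close> besides the roots makes all three powers of
    \<open>s\<close> nonzero.\<close>
  then have "finite (insert 0 {s. poly P s = 0})"
    by (simp add: poly_roots_finite)
  then obtain s where s: "s \<noteq> 0" "poly P s \<noteq> 0"
    using ex_new_if_finite[OF infinite_UNIV_char_0] by blast
  have "poly P s = (\<Sum>(i, j, k)\<in>K. c (i, j, k) * s ^ i * (s ^ N) ^ j * (s ^ (N * N)) ^ k)"
    unfolding P_def poly_sum
    by (rule sum.cong)
      (auto simp: poly_monom e_def power_add power_mult distrib_left mult.assoc)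
  with s show ?thesis
    by (intro exI[of _ s] exI[of _ "s ^ N"] exI[of _ "s ^ (N * N)"]) simp
qed

lemma eval3_inject:
  assumes "\<And>x y z. eval3 f x y z = eval3 g x y z"
  shows "f = g"
proof (rule ccontr)
  assume "f \<noteq> g"
  then obtain p where p: "p \<in> Poly_Mapping.keys (f - g)"
    by (metis in_keys_iff lookup_zero poly_mapping_eqI right_minus_eq)
  then obtain x y z where "eval3 (f - g) x y z \<noteq> 0"
    unfolding eval3_def
    using exists_nonzero_value[of "Poly_Mapping.keys (f - g)" p "\<lambda>p. of_int (Poly_Mapping.lookup (f
        - g) p)"]
    by (auto simp: in_keys_iff)
  then show False
    using assms by (simp add: eval3_minus)
qed

lemma total_degree_ge:
  "(i, j, k) \<in> Poly_Mapping.keys f \<Longrightarrow> i + j + k \<le> total_degree f"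
  unfolding total_degree_def by (rule Max_ge) force+

lemma total_degree_attained:
  assumes "f \<noteq> 0"
  shows "\<exists>i j k. (i, j, k) \<in> Poly_Mapping.keys f \<and> i + j + k = total_degree f"
proof -
  have ne: "Poly_Mapping.keys f \<noteq> {}"
    using assms by simp
  have "total_degree f \<in> insert 0 ((\<lambda>(i, j, k). i + j + k) ` Poly_Mapping.keys f)"
    unfolding total_degree_def by (rule Max_in) auto
  then consider "total_degree f = 0" | "total_degree f \<in> (\<lambda>(i, j, k). i + j + k) ` Poly_Mapping.keys f"
    by (metis insertE)
  then show ?thesis
  proof cases
    \<comment> \<open>The maximum may come from the inserted \<open>0\<close>; then every monomial
      has degree \<open>0\<close> and any key serves.\<close>
    case 1
    obtain i j k where "(i, j, k) \<in> Poly_Mapping.keys f"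
      using ne by (metis ex_in_conv prod_cases3)
    with total_degree_ge[OF this] 1 show ?thesis
      by auto
  next
    case 2
    then obtain i j k where "(i, j, k) \<in> Poly_Mapping.keys f" "i + j + k = total_degree f"
      by auto
    then show ?thesis
      by blast
  qed
qed

section \<open>Growth of polynomials along linearly growing arguments\<close>

lemma tendsto_inverse_of_nat_power:
  "(\<lambda>n. 1 / (of_nat n :: complex) ^ Suc m) \<longlonglongrightarrow> 0"
proof -
  have "(\<lambda>n. (1 / (of_nat n :: complex)) ^ Suc m) \<longlonglongrightarrow> 0 ^ Suc m"
    by (intro tendsto_power lim_1_over_n)
  then show ?thesis
    by (simp add: power_divide)
qed

text \<open>Dividing by a larger power than the true one forces the limit \<open>0\<close>. The
  degree is found this way: \<open>total_degree\<close> and \<open>linear_degree\<close> will both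
  be growth exponents of one sequence.\<close>

lemma growth_exponent_unique:
  fixes g :: "nat \<Rightarrow> complex"
  assumes "(\<lambda>n. g n / of_nat n ^ d) \<longlonglongrightarrow> L" "(\<lambda>n. g n / of_nat n ^ e) \<longlonglongrightarrow> M" "L \<noteq> 0" "M \<noteq> 0"
  shows "d = e"
proof -
  have aux: "\<not> d' < e'"
    if "(\<lambda>n. g n / of_nat n ^ d') \<longlonglongrightarrow> L'" "(\<lambda>n. g n / of_nat n ^ e') \<longlonglongrightarrow> M'" "M' \<noteq> 0" for d' e' L' M'
  proof
    assume "d' < e'"
    then obtain m where e': "e' = d' + Suc m"
      using less_imp_Suc_add by fastforce
    have "(\<lambda>n. g n / of_nat n ^ d' * (1 / of_nat n ^ Suc m)) \<longlonglongrightarrow> L' * 0"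
      by (intro tendsto_mult that(1) tendsto_inverse_of_nat_power)
    then have "(\<lambda>n. g n / of_nat n ^ e') \<longlonglongrightarrow> 0"
      by (simp add: e' power_add field_simps)
    with that(2,3) show False
      using LIMSEQ_unique by blast
  qed
  show ?thesis
    using aux[OF assms(1,2,4)] aux[OF assms(2,1,3)] by simp
qed

text \<open>The third argument has the shape \<tau> + 1/\<tau> with \<tau> =
  \<open>z * of_nat n\<close>, the trace of the product of the test pair; the summand 1/\<tau> does
  not affect the leading term.\<close>

lemma monom_growth:
  fixes x y z :: complex
  assumes "z \<noteq> 0" "i + j + k \<le> d"
  shows "(\<lambda>n. (x * of_nat n) ^ i * (y * of_nat n) ^ j * (z * of_nat n + 1 / (z * of_nat n)) ^ k /
      of_nat n ^ d)
    \<longlonglongrightarrow> (if i + j + k = d then x ^ i * y ^ j * z ^ k else 0)"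
proof -
  define m where "m = d - (i + j + k)"
  have d: "d = i + j + k + m"
    using assms(2) by (simp add: m_def)
  have z: "(\<lambda>n. z + 1 / z * (1 / (of_nat n :: complex) ^ Suc 1)) \<longlonglongrightarrow> z + 1 / z * 0"
    by (intro tendsto_intros tendsto_inverse_of_nat_power)
  have m: "(\<lambda>n. 1 / (of_nat n :: complex) ^ m) \<longlonglongrightarrow> of_bool (m = 0)"
    using tendsto_inverse_of_nat_power by (cases m) (auto simp del: power_Suc)
  have "(\<lambda>n. x ^ i * y ^ j * (z + 1 / z * (1 / (of_nat n :: complex) ^ Suc 1)) ^ k * (1 / of_nat n ^ m))
     \<longlonglongrightarrow> x ^ i * y ^ j * (z + 1 / z * 0) ^ k * of_bool (m = 0)"
    by (intro tendsto_mult tendsto_power tendsto_const m z)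
  also have "x ^ i * y ^ j * (z + 1 / z * 0) ^ k * of_bool (m = 0)
     = (if i + j + k = d then x ^ i * y ^ j * z ^ k else 0)"
    by (auto simp: d)
  finally show ?thesis
  proof (rule Lim_transform_eventually)
    show "\<forall>\<^sub>F n in sequentially. x ^ i * y ^ j * (z + 1 / z * (1 / (of_nat n :: complex) ^ Suc 1)) ^
        k * (1 / of_nat n ^ m)
      = (x * of_nat n) ^ i * (y * of_nat n) ^ j * (z * of_nat n + 1 / (z * of_nat n)) ^ k / of_nat n ^ d"
      using eventually_gt_at_top[of 0]
    proof eventually_elim
      case (elim n)
      have "z * of_nat n + 1 / (z * of_nat n) = of_nat n * (z + 1 / z * (1 / (of_nat n :: complex) ^
          Suc 1))"
        using elim assms(1) by (simp add: field_simps power2_eq_square)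
      then show ?case
        using elim by (simp add: d power_add power_mult_distrib)
    qed
  qed
qed

text \<open>The direction \<open>(x, y, z)\<close> is chosen off the zero set of the top homogeneous
  part (the coefficients \<open>c\<close>) and off the coordinate planes, where the rank-one
  analysis of words would degenerate.\<close>

lemma eval3_growth:
  assumes "f \<noteq> 0"
  shows "\<exists>x y z L. x \<noteq> 0 \<and> y \<noteq> 0 \<and> z \<noteq> 0 \<and> L \<noteq> 0 \<and>
    (\<lambda>n. eval3 f (x * of_nat n) (y * of_nat n) (z * of_nat n + 1 / (z * of_nat n)) / of_nat n ^
        total_degree f)
      \<longlonglongrightarrow> L"
proof -
  let ?d = "total_degree f"
  define c :: "nat \<times> nat \<times> nat \<Rightarrow> complex"
    where "c = (\<lambda>(i, j, k). if i + j + k = ?d then of_int (Poly_Mapping.lookup f (i, j, k)) else 0)"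
  obtain p where "p \<in> Poly_Mapping.keys f" "c p \<noteq> 0"
    using total_degree_attained[OF assms] by (auto simp: c_def in_keys_iff)
  then obtain x y z where xyz: "x \<noteq> 0" "y \<noteq> 0" "z \<noteq> 0"
    "(\<Sum>(i, j, k)\<in>Poly_Mapping.keys f. c (i, j, k) * x ^ i * y ^ j * z ^ k) \<noteq> 0"
    using exists_nonzero_value[of "Poly_Mapping.keys f" p c] by auto
  have "(\<lambda>n. \<Sum>(i, j, k)\<in>Poly_Mapping.keys f. of_int (Poly_Mapping.lookup f (i, j, k)) *
      ((x * of_nat n) ^ i * (y * of_nat n) ^ j * (z * of_nat n + 1 / (z * of_nat n)) ^ k / of_nat n
          ^ ?d))
    \<longlonglongrightarrow> (\<Sum>(i, j, k)\<in>Poly_Mapping.keys f. of_int (Poly_Mapping.lookup f (i, j, k)) *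
        (if i + j + k = ?d then x ^ i * y ^ j * z ^ k else 0))"
    unfolding case_prod_unfold
    by (intro tendsto_sum tendsto_mult tendsto_const monom_growth)
      (use xyz in \<open>auto intro: total_degree_ge\<close>)
  also have "(\<Sum>(i, j, k)\<in>Poly_Mapping.keys f. of_int (Poly_Mapping.lookup f (i, j, k)) *
        (if i + j + k = ?d then x ^ i * y ^ j * z ^ k else 0))
     = (\<Sum>(i, j, k)\<in>Poly_Mapping.keys f. c (i, j, k) * x ^ i * y ^ j * z ^ k)"
    by (rule sum.cong) (auto simp: c_def)
  finally show ?thesis
    using xyz unfolding eval3_def
    by (intro exI conjI) (simp_all add: sum_divide_distrib case_prod_unfold mult.assoc)
qed

section \<open>Trace polynomials\<close>

definition mat2 :: "complex \<Rightarrow> complex \<Rightarrow> complex \<Rightarrow> complex \<Rightarrow> complex^2^2" where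
  "mat2 a b c d = vector [vector [a, b], vector [c, d]]"

lemma mat2_nth [simp]:
  "mat2 a b c d $ 1 $ 1 = a" "mat2 a b c d $ 1 $ 2 = b"
  "mat2 a b c d $ 2 $ 1 = c" "mat2 a b c d $ 2 $ 2 = d"
  by (simp_all add: mat2_def)

lemma mat2_eqI:
  fixes A B :: "complex^2^2"
  assumes "A $ 1 $ 1 = B $ 1 $ 1" "A $ 1 $ 2 = B $ 1 $ 2" "A $ 2 $ 1 = B $ 2 $ 1" "A $ 2 $ 2 = B $ 2 $ 2"
  shows "A = B"
  using assms by (simp add: vec_eq_iff forall_2)

lemma mat2_cases: obtains a b c d where "A = mat2 a b c d"
  using mat2_eqI[of A "mat2 (A$1$1) (A$1$2) (A$2$1) (A$2$2)"] by simp

lemma matrix_mult_nth2: "((A :: complex^2^2) ** B) $ i $ j = A $ i $ 1 * B $ 1 $ j + A $ i $ 2 * B $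
    2 $ j"
  by (simp add: matrix_matrix_mult_def sum_2)

lemma mat2_mult:
  "mat2 a b c d ** mat2 a' b' c' d' = mat2 (a * a' + b * c') (a * b' + b * d') (c * a' + d * c') (c
      * b' + d * d')"
  by (rule mat2_eqI) (simp_all add: matrix_mult_nth2)

lemma mat_1_mat2: "mat 1 = mat2 1 0 0 1"
  by (rule mat2_eqI) (simp_all add: mat_def)

lemma trace_nth2: "trace (A :: complex^2^2) = A $ 1 $ 1 + A $ 2 $ 2"
  by (simp add: trace_def sum_2)

lemma mat2_in_SL2C: "mat2 a b c d \<in> SL2C \<longleftrightarrow> a * d - b * c = 1"
  by (simp add: SL2C_def det_2)

lemma matrix_inv_mat2:
  assumes "a * d - b * c = 1"
  shows "matrix_inv (mat2 a b c d) = mat2 d (- b) (- c) a"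
proof -
  let ?A = "mat2 a b c d" and ?B = "mat2 d (- b) (- c) a"
  have AB: "?A ** ?B = mat 1" and BA: "?B ** ?A = mat 1"
    using assms by (simp_all add: mat2_mult mat_1_mat2 algebra_simps)
  then have "invertible ?A"
    unfolding invertible_def by blast
  then have "matrix_inv ?A = matrix_inv ?A ** (?A ** ?B)"
    by (simp add: AB)
  also have "\<dots> = ?B"
    using matrix_inv_cancel(2)[OF \<open>invertible ?A\<close>] by (simp add: matrix_mul_assoc)
  finally show ?thesis .
qed

text \<open>
  The pair below has traces \<open>x\<close>, \<open>y\<close> and \<open>\<tau> + 1/\<tau>\<close>. It is chosen such that, for \<open>x\<close>, \<open>y\<close>, \<open>\<tau>\<close>
  growing linearly, both matrices, their inverses and their product have only linear growth.
\<close>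

definition trace_A :: "complex \<Rightarrow> complex^2^2" where
  "trace_A x = mat2 x (- 1) 1 0"

definition trace_B :: "complex \<Rightarrow> complex \<Rightarrow> complex^2^2" where
  "trace_B y \<tau> = mat2 0 (1 / \<tau>) (- \<tau>) y"

lemma trace_A_SL2C: "trace_A x \<in> SL2C"
  by (simp add: trace_A_def mat2_in_SL2C)

lemma trace_B_SL2C: "\<tau> \<noteq> 0 \<Longrightarrow> trace_B y \<tau> \<in> SL2C"
  by (simp add: trace_B_def mat2_in_SL2C)

lemma trace_A_B:
  "trace (trace_A x) = x" "trace (trace_B y \<tau>) = y" "trace (trace_A x ** trace_B y \<tau>) = \<tau> + 1 / \<tau>"
  by (simp_all add: trace_A_def trace_B_def trace_nth2 matrix_mult_nth2)

text \<open>\<tau> is a root of the quadratic T^2 - zT + 1. Hence the pair \<open>trace_A\<close>,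
  \<open>trace_B\<close> realises every triple of traces, which makes trace polynomials
  unique.\<close>

lemma exists_plus_inverse:
  fixes z :: complex
  obtains \<tau> where "\<tau> \<noteq> 0" "\<tau> + 1 / \<tau> = z"
proof -
  define q where "q = csqrt (z\<^sup>2 - 4)"
  define \<tau> where "\<tau> = (z + q) / 2"
  have "q * q = z * z - 4"
    by (metis power2_csqrt power2_eq_square q_def)
  moreover have "\<tau> * \<tau> + 1 - z * \<tau> = (q * q - (z * z - 4)) / 4"
    by (simp add: \<tau>_def field_simps)
  ultimately have eq: "\<tau> * \<tau> + 1 = z * \<tau>"
    by simp
  then have "\<tau> \<noteq> 0"
    by auto
  then have "\<tau> + 1 / \<tau> = z"
    using eq by (simp add: field_simps)
  with \<open>\<tau> \<noteq> 0\<close> show ?thesis ..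
qed

text \<open>Functions induced by integer polynomials: the Cayley--Hamilton recursion can then be
  written with pointwise formulas instead of explicit elements of \<open>poly3\<close>.\<close>

definition eval3_funs :: "(complex \<Rightarrow> complex \<Rightarrow> complex \<Rightarrow> complex) set" where
  "eval3_funs = range eval3"

lemma eval3_funs_intros:
  "(\<lambda>x y z. 0) \<in> eval3_funs"
  "(\<lambda>x y z. 1) \<in> eval3_funs"
  "p \<in> eval3_funs \<Longrightarrow> q \<in> eval3_funs \<Longrightarrow> (\<lambda>x y z. p x y z + q x y z) \<in> eval3_funs"
  "p \<in> eval3_funs \<Longrightarrow> q \<in> eval3_funs \<Longrightarrow> (\<lambda>x y z. p x y z - q x y z) \<in> eval3_funs"
  "p \<in> eval3_funs \<Longrightarrow> (\<lambda>x y z. - p x y z) \<in> eval3_funs"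
  "p \<in> eval3_funs \<Longrightarrow> (\<lambda>x y z. x * p x y z) \<in> eval3_funs"
  "p \<in> eval3_funs \<Longrightarrow> (\<lambda>x y z. y * p x y z) \<in> eval3_funs"
  "p \<in> eval3_funs \<Longrightarrow> (\<lambda>x y z. z * p x y z) \<in> eval3_funs"
proof -
  have I: "\<exists>f. \<forall>x y z. p x y z = eval3 f x y z \<Longrightarrow> p \<in> eval3_funs" for p
    unfolding eval3_funs_def by (auto simp: fun_eq_iff image_iff)
  show "(\<lambda>x y z. 0) \<in> eval3_funs"
    by (rule I) (metis eval3_0)
  show "(\<lambda>x y z. 1) \<in> eval3_funs"
    by (rule I) (rule exI[of _ "Poly_Mapping.single (0, 0, 0) 1"], simp add: eval3_single)
  assume "p \<in> eval3_funs"
  then obtain f where f: "p = eval3 f"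
    by (auto simp: eval3_funs_def)
  show "(\<lambda>x y z. - p x y z) \<in> eval3_funs"
    by (rule I) (metis eval3_uminus f)
  show "(\<lambda>x y z. x * p x y z) \<in> eval3_funs"
    using eval3_mult_monom_ex[of 1 0 0 f] by (intro I) (simp add: f, metis)
  show "(\<lambda>x y z. y * p x y z) \<in> eval3_funs"
    using eval3_mult_monom_ex[of 0 1 0 f] by (intro I) (simp add: f, metis)
  show "(\<lambda>x y z. z * p x y z) \<in> eval3_funs"
    using eval3_mult_monom_ex[of 0 0 1 f] by (intro I) (simp add: f, metis)
  assume "q \<in> eval3_funs"
  then obtain g where g: "q = eval3 g"
    by (auto simp: eval3_funs_def)
  show "(\<lambda>x y z. p x y z + q x y z) \<in> eval3_funs"
    by (rule I) (metis eval3_add f g)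
  show "(\<lambda>x y z. p x y z - q x y z) \<in> eval3_funs"
    by (rule I) (metis eval3_minus f g)
qed

text \<open>
  The span of \<open>1, A, B, AB\<close> over \<open>\<int>[x,y,z]\<close> is closed under multiplication by letters
  (Cayley--Hamilton), which yields the existence of trace polynomials.
\<close>

definition comb :: "complex^2^2 \<Rightarrow> complex^2^2 \<Rightarrow> complex \<Rightarrow> complex \<Rightarrow> complex \<Rightarrow> complex \<Rightarrow> complex^2^2"
    where
  "comb A B p q r s = (\<chi> i j. p * mat 1 $ i $ j + q * A $ i $ j + r * B $ i $ j + s * (A ** B) $ i $ j)"

lemma comb_nth: "comb A B p q r s $ i $ j = p * mat 1 $ i $ j + q * A $ i $ j + r * B $ i $ j + s *
    (A ** B) $ i $ j"
  by (simp add: comb_def)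

text \<open>With x, y, z the three traces, the identities behind this are A^2 = xA - 1, A^-1 = x -
  A, their analogues for B, and BA = (z - xy) + yA + xB - AB.\<close>

lemma comb_mult:
  assumes "A \<in> SL2C" "B \<in> SL2C"
  defines "x \<equiv> trace A" and "y \<equiv> trace B" and "z \<equiv> trace (A ** B)"
  shows "A ** comb A B p q r s = comb A B (- q) (p + x * q) (- s) (r + x * s)"
    and "B ** comb A B p q r s
      = comb A B (z * q - x * (y * q) - r - x * s) (y * q + s) (p + x * q + y * r + z * s) (- q)"
    and "matrix_inv A ** comb A B p q r s = comb A B (x * p + q) (- p) (x * r + s) (- r)"
    and "matrix_inv B ** comb A B p q r s
      = comb A B (y * p - (z * q - x * (y * q) - r - x * s)) (- s) (- p - x * q - z * s) (y * s + q)"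
proof -
  obtain a b c d where A: "A = mat2 a b c d" by (rule mat2_cases)
  obtain e f g h where B: "B = mat2 e f g h" by (rule mat2_cases)
  have ab: "a * d - b * c = 1" and ef: "e * h - f * g = 1"
    using assms by (simp_all add: A B mat2_in_SL2C)
  note unfold = comb_nth matrix_mult_nth2 trace_nth2 mat_1_mat2 x_def y_def z_def A B mat2_nth
  \<comment> \<open>The determinant is kept as an explicit factor, so that every entry is a plain
    polynomial identity; only afterwards is it replaced by \<open>1\<close>. The other three cases
    follow the same pattern.\<close>
  have "A ** comb A B p q r s = comb A B (- ((a * d - b * c) * q)) (p + x * q) (- ((a * d - b * c) *
      s)) (r + x * s)"
    by (rule mat2_eqI; simp only: unfold; simp add: algebra_simps)
  then show "A ** comb A B p q r s = comb A B (- q) (p + x * q) (- s) (r + x * s)"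
    by (simp add: ab)
  have "B ** comb A B p q r s
      = comb A B (z * q - x * (y * q) - (e * h - f * g) * r - x * ((e * h - f * g) * s))
          (y * q + (e * h - f * g) * s) (p + x * q + y * r + z * s) (- q)"
    by (rule mat2_eqI; simp only: unfold; simp add: algebra_simps)
  then show "B ** comb A B p q r s
      = comb A B (z * q - x * (y * q) - r - x * s) (y * q + s) (p + x * q + y * r + z * s) (- q)"
    by (simp add: ef)
  have "mat2 d (- b) (- c) a ** comb A B p q r s
      = comb A B (x * p + (a * d - b * c) * q) (- p) (x * r + (a * d - b * c) * s) (- r)"
    by (rule mat2_eqI; simp only: unfold; simp add: algebra_simps)
  then show "matrix_inv A ** comb A B p q r s = comb A B (x * p + q) (- p) (x * r + s) (- r)"
    by (simp add: ab matrix_inv_mat2[OF ab] A)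
  have "mat2 h (- f) (- g) e ** comb A B p q r s
      = comb A B (y * p - (z * q - x * (y * q) - (e * h - f * g) * r - x * ((e * h - f * g) * s)))
          (- ((e * h - f * g) * s)) (- p - x * q - z * s) (y * s + q)"
    by (rule mat2_eqI; simp only: unfold; simp add: algebra_simps)
  then show "matrix_inv B ** comb A B p q r s
      = comb A B (y * p - (z * q - x * (y * q) - r - x * s)) (- s) (- p - x * q - z * s) (y * s + q)"
    by (simp add: ef matrix_inv_mat2[OF ef] B)
qed

definition comb_rep :: "word \<Rightarrow> bool" where
  "comb_rep w \<longleftrightarrow> (\<exists>p\<in>eval3_funs. \<exists>q\<in>eval3_funs. \<exists>r\<in>eval3_funs. \<exists>s\<in>eval3_funs.
    \<forall>A\<in>SL2C. \<forall>B\<in>SL2C. word_eval A B w = comb A B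
      (p (trace A) (trace B) (trace (A ** B))) (q (trace A) (trace B) (trace (A ** B)))
      (r (trace A) (trace B) (trace (A ** B))) (s (trace A) (trace B) (trace (A ** B))))"

lemma comb_repI:
  assumes "p \<in> eval3_funs" "q \<in> eval3_funs" "r \<in> eval3_funs" "s \<in> eval3_funs"
    and "\<And>A B. A \<in> SL2C \<Longrightarrow> B \<in> SL2C \<Longrightarrow> word_eval A B w = comb A B
      (p (trace A) (trace B) (trace (A ** B))) (q (trace A) (trace B) (trace (A ** B)))
      (r (trace A) (trace B) (trace (A ** B))) (s (trace A) (trace B) (trace (A ** B)))"
  shows "comb_rep w"
  using assms unfolding comb_rep_def by blast

lemma comb_repE:
  assumes "comb_rep w"
  obtains p q r s where
    "p \<in> eval3_funs" "q \<in> eval3_funs" "r \<in> eval3_funs" "s \<in> eval3_funs"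
    "\<And>A B. A \<in> SL2C \<Longrightarrow> B \<in> SL2C \<Longrightarrow> word_eval A B w = comb A B
      (p (trace A) (trace B) (trace (A ** B))) (q (trace A) (trace B) (trace (A ** B)))
      (r (trace A) (trace B) (trace (A ** B))) (s (trace A) (trace B) (trace (A ** B)))"
  using assms unfolding comb_rep_def by blast

lemma comb_rep_word: "comb_rep w"
proof (induction w)
  case Nil
  show ?case
    by (rule comb_repI[of "\<lambda>x y z. 1" "\<lambda>x y z. 0" "\<lambda>x y z. 0" "\<lambda>x y z. 0"])
      (intro eval3_funs_intros | simp add: vec_eq_iff comb_nth)+
next
  case (Cons l w)
  then obtain p q r s
    where mem: "p \<in> eval3_funs" "q \<in> eval3_funs" "r \<in> eval3_funs" "s \<in> eval3_funs"
    and eq: "\<And>A B. A \<in> SL2C \<Longrightarrow> B \<in> SL2C \<Longrightarrow> word_eval A B w = comb A B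
      (p (trace A) (trace B) (trace (A ** B))) (q (trace A) (trace B) (trace (A ** B)))
      (r (trace A) (trace B) (trace (A ** B))) (s (trace A) (trace B) (trace (A ** B)))"
    by (rule comb_repE) blast
  note I = comb_repI[where w = "l # w"]
  show ?case
  proof (cases l)
    case LA
    show ?thesis
      by (rule I[of "\<lambda>x y z. - q x y z" "\<lambda>x y z. p x y z + x * q x y z"
            "\<lambda>x y z. - s x y z" "\<lambda>x y z. r x y z + x * s x y z"])
        (intro eval3_funs_intros mem | simp add: LA eq comb_mult)+
  next
    case LA_inv
    show ?thesis
      by (rule I[of "\<lambda>x y z. x * p x y z + q x y z" "\<lambda>x y z. - p x y z"
            "\<lambda>x y z. x * r x y z + s x y z" "\<lambda>x y z. - r x y z"])
        (intro eval3_funs_intros mem | simp add: LA_inv eq comb_mult)+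
  next
    case LB
    show ?thesis
      by (rule I[of "\<lambda>x y z. z * q x y z - x * (y * q x y z) - r x y z - x * s x y z" "\<lambda>x y z. y * q
          x y z + s x y z"
            "\<lambda>x y z. p x y z + x * q x y z + y * r x y z + z * s x y z" "\<lambda>x y z. - q x y z"])
        (intro eval3_funs_intros mem | simp add: LB eq comb_mult)+
  next
    case LB_inv
    show ?thesis
      by (rule I[of "\<lambda>x y z. y * p x y z - (z * q x y z - x * (y * q x y z) - r x y z - x * s x y
          z)" "\<lambda>x y z. - s x y z"
            "\<lambda>x y z. - p x y z - x * q x y z - z * s x y z" "\<lambda>x y z. y * s x y z + q x y z"])
        (intro eval3_funs_intros mem | simp add: LB_inv eq comb_mult)+
  qed
qed

lemma trace_comb:
  "trace (comb A B p q r s) = p + p + trace A * q + trace B * r + trace (A ** B) * s"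
  by (simp add: trace_nth2 comb_nth mat_1_mat2 algebra_simps)

text \<open>Makes the description in \<open>trace_poly\<close> meaningful. Existence takes the trace
  of the combination from \<open>comb_rep_word\<close>; uniqueness evaluates at the pair
  \<open>trace_A\<close>, \<open>trace_B\<close>.\<close>

lemma trace_poly_ex1:
  "\<exists>!f. \<forall>A\<in>SL2C. \<forall>B\<in>SL2C. trace (word_eval A B w) = eval3 f (trace A) (trace B) (trace (A ** B))"
proof (rule ex_ex1I)
  obtain p q r s
    where mem: "p \<in> eval3_funs" "q \<in> eval3_funs" "r \<in> eval3_funs" "s \<in> eval3_funs"
    and eq: "\<And>A B. A \<in> SL2C \<Longrightarrow> B \<in> SL2C \<Longrightarrow> word_eval A B w = comb A B
      (p (trace A) (trace B) (trace (A ** B))) (q (trace A) (trace B) (trace (A ** B)))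
      (r (trace A) (trace B) (trace (A ** B))) (s (trace A) (trace B) (trace (A ** B)))"
    using comb_rep_word by (rule comb_repE) blast
  have "(\<lambda>x y z. p x y z + p x y z + x * q x y z + y * r x y z + z * s x y z) \<in> eval3_funs"
    by (intro eval3_funs_intros mem)
  then obtain f where f: "(\<lambda>x y z. p x y z + p x y z + x * q x y z + y * r x y z + z * s x y z) =
      eval3 f"
    unfolding eval3_funs_def by (rule rangeE)
  show "\<exists>f. \<forall>A\<in>SL2C. \<forall>B\<in>SL2C. trace (word_eval A B w) = eval3 f (trace A) (trace B) (trace (A ** B))"
  proof (intro exI ballI)
    fix A B assume "A \<in> SL2C" "B \<in> SL2C"
    show "trace (word_eval A B w) = eval3 f (trace A) (trace B) (trace (A ** B))"
      by (simp only: eq[OF \<open>A \<in> SL2C\<close> \<open>B \<in> SL2C\<close>] trace_comb f[symmetric])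
  qed
next
  fix f g
  assume f: "\<forall>A\<in>SL2C. \<forall>B\<in>SL2C. trace (word_eval A B w) = eval3 f (trace A) (trace B) (trace (A ** B))"
    and g: "\<forall>A\<in>SL2C. \<forall>B\<in>SL2C. trace (word_eval A B w) = eval3 g (trace A) (trace B) (trace (A ** B))"
  show "f = g"
  proof (rule eval3_inject)
    fix x y z :: complex
    obtain \<tau> where "\<tau> \<noteq> 0" "\<tau> + 1 / \<tau> = z"
      by (rule exists_plus_inverse)
    then show "eval3 f x y z = eval3 g x y z"
      using f[rule_format, OF trace_A_SL2C[of x] trace_B_SL2C[of \<tau> y]]
        g[rule_format, OF trace_A_SL2C[of x] trace_B_SL2C[of \<tau> y]]
      by (simp add: trace_A_B)
  qed
qed

lemma eval3_trace_poly:
  assumes "A \<in> SL2C" "B \<in> SL2C"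
  shows "eval3 (trace_poly w) (trace A) (trace B) (trace (A ** B)) = trace (word_eval A B w)"
proof -
  have "\<forall>A\<in>SL2C. \<forall>B\<in>SL2C. trace (word_eval A B w)
      = eval3 (trace_poly w) (trace A) (trace B) (trace (A ** B))"
    unfolding trace_poly_def by (rule theI'[OF trace_poly_ex1])
  then show ?thesis
    using assms by simp
qed

section \<open>Conjugation invariance of trace polynomials\<close>

lemma trace_poly_cong:
  assumes "\<And>A B. A \<in> SL2C \<Longrightarrow> B \<in> SL2C \<Longrightarrow> trace (word_eval A B w) = trace (word_eval A B w')"
  shows "trace_poly w = trace_poly w'"
proof -
  have "(\<forall>A\<in>SL2C. \<forall>B\<in>SL2C. trace (word_eval A B w) = eval3 f (trace A) (trace B) (trace (A ** B)))
    \<longleftrightarrow> (\<forall>A\<in>SL2C. \<forall>B\<in>SL2C. trace (word_eval A B w') = eval3 f (trace A) (trace B) (trace (A ** B)))" for f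
    by (intro ball_cong refl) (simp only: assms)
  then show ?thesis
    unfolding trace_poly_def by simp
qed

lemma trace_poly_rotate: "trace_poly (u @ v) = trace_poly (v @ u)"
  by (rule trace_poly_cong) (unfold word_eval_append, rule trace_mul_sym)

text \<open>Rotating the first letter of \<open>u\<close> to the end puts it next to its inverse,
  where it cancels.\<close>

lemma trace_poly_conjugate: "trace_poly (u @ c @ rev (map inv_letter u)) = trace_poly c"
proof (induction u arbitrary: c)
  case (Cons l u)
  have "trace_poly ((l # u) @ c @ rev (map inv_letter (l # u)))
      = trace_poly ([l] @ ((u @ c @ rev (map inv_letter u)) @ [inv_letter l]))"
    by simp
  also have "\<dots> = trace_poly ((u @ c @ rev (map inv_letter u)) @ [inv_letter l, l])"
    by (subst trace_poly_rotate) simp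
  also have "\<dots> = trace_poly (u @ c @ rev (map inv_letter u))"
  proof (rule trace_poly_cong)
    fix A B :: "complex^2^2" assume "A \<in> SL2C" "B \<in> SL2C"
    then show "trace (word_eval A B ((u @ c @ rev (map inv_letter u)) @ [inv_letter l, l]))
        = trace (word_eval A B (u @ c @ rev (map inv_letter u)))"
      using word_eval_cancel[of A B "u @ c @ rev (map inv_letter u)" "inv_letter l" "[]"]
      by (cases l) simp_all
  qed
  finally show ?case
    using Cons by simp
qed simp

section \<open>The degree of a trace polynomial\<close>

text \<open>
  A junction from a hot to a cold letter in a reduced word is \<open>ab\<close> or \<open>b\<^sup>-\<^sup>1a\<^sup>-\<^sup>1\<close>; these are the
  junctions where the product of the two letter matrices grows only linearly.
\<close>

definition hot :: "letter \<Rightarrow> bool" where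
  "hot l \<longleftrightarrow> l = LA \<or> l = LB_inv"

text \<open>The growth exponent of the matrix of a reduced word: its length minus the number of
  hot-to-cold junctions, the closing junction from last to first letter not counted.\<close>

fun linear_degree :: "word \<Rightarrow> nat" where
  "linear_degree [] = 0"
| "linear_degree [l] = 1"
| "linear_degree (l # m # w) = of_bool (hot l \<longrightarrow> hot m) + linear_degree (m # w)"

fun switches :: "word \<Rightarrow> nat" where
  "switches (l # m # w) = of_bool (hot l \<noteq> hot m) + switches (m # w)"
| "switches _ = 0"

lemma linear_degree_snoc:
  "w \<noteq> [] \<Longrightarrow> linear_degree (w @ [l]) = linear_degree w + of_bool (hot (last w) \<longrightarrow> hot l)"
  by (induction w rule: linear_degree.induct) auto

lemma switches_Cons: "switches w \<le> switches (l # w)" "switches (l # w) \<le> Suc (switches w)"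
  by (cases w; simp)+

lemma switches_snoc: "switches w \<le> switches (w @ [l])" "switches (w @ [l]) \<le> Suc (switches w)"
  by (induction w rule: switches.induct) auto

text \<open>Hot-to-cold and cold-to-hot junctions alternate, so their numbers differ by the boundary
  terms only; the junctions missing in \<open>linear_degree\<close> are thus about half of
  \<open>switches\<close>.\<close>

lemma linear_degree_switches:
  "w \<noteq> [] \<Longrightarrow>
    2 * linear_degree w + switches w + of_bool (hot (hd w)) = 2 * length w + of_bool (hot (last w))"
  by (induction w rule: linear_degree.induct) (auto simp: of_bool_def split: if_splits)

lemma inv_letter_inv_letter [simp]: "inv_letter (inv_letter l) = l"
  by (cases l) auto

text \<open>
  The leading coefficient of each letter matrix is, up to a scalar, the rank-one matrix
  \<open>col_vec \<cdot> row_vec\<close>; on the junctions \<open>ab\<close> and \<open>b\<^sup>-\<^sup>1a\<^sup>-\<^sup>1\<close> row and column are orthogonal.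
\<close>

fun col_vec :: "complex \<Rightarrow> complex \<Rightarrow> letter \<Rightarrow> complex^2" where
  "col_vec y z LA = vector [1, 0]"
| "col_vec y z LA_inv = vector [0, 1]"
| "col_vec y z LB = vector [0, 1]"
| "col_vec y z LB_inv = vector [y, z]"

fun row_vec :: "complex \<Rightarrow> complex \<Rightarrow> letter \<Rightarrow> complex^2" where
  "row_vec y z LA = vector [1, 0]"
| "row_vec y z LA_inv = vector [0, 1]"
| "row_vec y z LB = vector [- z, y]"
| "row_vec y z LB_inv = vector [1, 0]"

text \<open>Bilinear, without complex conjugation, since it arises from matrix products.\<close>

definition pairing :: "complex^2 \<Rightarrow> complex^2 \<Rightarrow> complex" where
  "pairing v u = v $ 1 * u $ 1 + v $ 2 * u $ 2"

text \<open>On each of the ten admissible junctions the value is \<open>1\<close>, \<open>y\<close>,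
  \<open>z\<close> or \<open>- z\<close>.\<close>

lemma pairing_nonzero:
  assumes "y \<noteq> 0" "z \<noteq> 0" "m \<noteq> inv_letter l" "hot l \<longrightarrow> hot m"
  shows "pairing (row_vec y z l) (col_vec y z m) \<noteq> 0"
  using assms by (cases l; cases m) (auto simp: pairing_def hot_def)

text \<open>The scalar \<kappa> is kept apart from the directions: these depend only on the outer
  letters of a word, and nonvanishing is a statement about \<kappa> alone.\<close>

definition rank_one_limit ::
  "(nat \<Rightarrow> complex^2^2) \<Rightarrow> nat \<Rightarrow> complex \<Rightarrow> complex^2 \<Rightarrow> complex^2 \<Rightarrow> bool" where
  "rank_one_limit X d \<kappa> u v \<longleftrightarrow> (\<forall>i j. (\<lambda>n. X n $ i $ j / of_nat n ^ d) \<longlonglongrightarrow> \<kappa> * u $ i * v $ j)"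

text \<open>A product of rank-one matrices is rank one: the inner row and column contract to the
  scalar \<open>pairing v u'\<close>.\<close>

lemma rank_one_limit_mult:
  assumes "rank_one_limit X d \<kappa> u v" "rank_one_limit X' d' \<kappa>' u' v'"
  shows "rank_one_limit (\<lambda>n. X n ** X' n) (d + d') (\<kappa> * pairing v u' * \<kappa>') u v'"
  unfolding rank_one_limit_def
proof (intro allI)
  fix i j
  have "(\<lambda>n. X n $ i $ 1 / of_nat n ^ d * (X' n $ 1 $ j / of_nat n ^ d')
      + X n $ i $ 2 / of_nat n ^ d * (X' n $ 2 $ j / of_nat n ^ d'))
    \<longlonglongrightarrow> \<kappa> * u $ i * v $ 1 * (\<kappa>' * u' $ 1 * v' $ j) + \<kappa> * u $ i * v $ 2 * (\<kappa>' * u' $ 2 * v' $ j)"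
    using assms unfolding rank_one_limit_def by (intro tendsto_add tendsto_mult) auto
  then show "(\<lambda>n. (X n ** X' n) $ i $ j / of_nat n ^ (d + d')) \<longlonglongrightarrow> \<kappa> * pairing v u' * \<kappa>' * u $ i * v' $ j"
    by (simp add: matrix_mult_nth2 pairing_def power_add add_divide_distrib algebra_simps)
qed

lemma rank_one_limit_trace:
  assumes "rank_one_limit X d \<kappa> u v"
  shows "(\<lambda>n. trace (X n) / of_nat n ^ d) \<longlonglongrightarrow> \<kappa> * pairing v u"
proof -
  have "(\<lambda>n. X n $ 1 $ 1 / of_nat n ^ d + X n $ 2 $ 2 / of_nat n ^ d) \<longlonglongrightarrow> \<kappa> * u $ 1 * v $ 1 + \<kappa> * u $
      2 * v $ 2"
    using assms unfolding rank_one_limit_def by (intro tendsto_add) auto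
  then show ?thesis
    by (simp add: trace_nth2 pairing_def add_divide_distrib algebra_simps)
qed

lemma affine_limit:
  "(\<lambda>n. (p + q * of_nat n + r / of_nat n) / of_nat n :: complex) \<longlonglongrightarrow> q"
proof -
  have "(\<lambda>n. p * (1 / of_nat n) + q + r * (1 / of_nat n) * (1 / of_nat n)) \<longlonglongrightarrow> p * 0 + q + r * 0 * 0"
    by (intro tendsto_intros lim_1_over_n)
  then have "(\<lambda>n. p * (1 / of_nat n) + q + r * (1 / of_nat n) * (1 / of_nat n)) \<longlonglongrightarrow> q"
    by simp
  then show ?thesis
  proof (rule Lim_transform_eventually)
    show "\<forall>\<^sub>F n in sequentially. p * (1 / of_nat n) + q + r * (1 / of_nat n) * (1 / of_nat n)
      = (p + q * of_nat n + r / of_nat n) / of_nat n"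
      using eventually_gt_at_top[of 0] by eventually_elim (simp add: field_simps)
  qed
qed

text \<open>Instances list the constant and 1/n coefficients \<open>p1\<close>, \<open>r1\<close>,
  ..., \<open>p4\<close>, \<open>r4\<close> of the entries. The assumption is only eventual because
  \<open>B_seq 0\<close> is singular.\<close>

lemma rank_one_limit_affine:
  assumes "\<forall>\<^sub>F n in sequentially. X n = mat2
      (p1 + \<kappa> * u $ 1 * v $ 1 * of_nat n + r1 / of_nat n) (p2 + \<kappa> * u $ 1 * v $ 2 * of_nat n + r2 /
          of_nat n)
      (p3 + \<kappa> * u $ 2 * v $ 1 * of_nat n + r3 / of_nat n) (p4 + \<kappa> * u $ 2 * v $ 2 * of_nat n + r4 /
          of_nat n)"
  shows "rank_one_limit X 1 \<kappa> u v"
proof -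
  have *: "(\<lambda>n. X n $ i $ j / of_nat n) \<longlonglongrightarrow> \<kappa> * u $ i * v $ j"
    if "\<forall>\<^sub>F n in sequentially. X n $ i $ j = p + \<kappa> * u $ i * v $ j * of_nat n + r / of_nat n" for i j p r
    by (rule Lim_transform_eventually[OF affine_limit[of p "\<kappa> * u $ i * v $ j" r]])
      (use that in \<open>eventually_elim, simp\<close>)
  show ?thesis
    unfolding rank_one_limit_def forall_2 power_one_right
    by (intro conjI; rule *; rule eventually_mono[OF assms]) simp_all
qed

context
  fixes x y z :: complex
  assumes nz: "x \<noteq> 0" "y \<noteq> 0" "z \<noteq> 0"
begin

abbreviation A_seq :: "nat \<Rightarrow> complex^2^2" where "A_seq n \<equiv> trace_A (x * of_nat n)"
abbreviation B_seq :: "nat \<Rightarrow> complex^2^2" where "B_seq n \<equiv> trace_B (y * of_nat n) (z * of_nat n)"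

lemma letter_seq:
  "letter_eval (A_seq n) (B_seq n) LA = mat2 (x * of_nat n) (- 1) 1 0"
  "letter_eval (A_seq n) (B_seq n) LA_inv = mat2 0 1 (- 1) (x * of_nat n)"
  "letter_eval (A_seq n) (B_seq n) LB = mat2 0 (1 / z / of_nat n) (- (z * of_nat n)) (y * of_nat n)"
  "n > 0 \<Longrightarrow> letter_eval (A_seq n) (B_seq n) LB_inv
    = mat2 (y * of_nat n) (- (1 / z) / of_nat n) (z * of_nat n) 0"
  using nz by (simp_all add: trace_A_def trace_B_def matrix_inv_mat2)

lemma letter_limit:
  "\<exists>\<kappa>. \<kappa> \<noteq> 0 \<and> rank_one_limit (\<lambda>n. letter_eval (A_seq n) (B_seq n) l) 1 \<kappa> (col_vec y z l) (row_vec y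
      z l)"
proof (cases l)
  case LA
  have "rank_one_limit (\<lambda>n. letter_eval (A_seq n) (B_seq n) LA) 1 x (col_vec y z LA) (row_vec y z LA)"
    by (rule rank_one_limit_affine[of _ 0 _ _ _ 0 "- 1" 0 1 0 0 0]) (simp add: letter_seq del:
        letter_eval.simps)
  then show ?thesis
    unfolding LA using nz by (intro exI[of _ x] conjI)
next
  case LA_inv
  have "rank_one_limit (\<lambda>n. letter_eval (A_seq n) (B_seq n) LA_inv) 1 x (col_vec y z LA_inv)
      (row_vec y z LA_inv)"
    by (rule rank_one_limit_affine[of _ 0 _ _ _ 0 1 0 "- 1" 0 0 0]) (simp add: letter_seq del:
        letter_eval.simps)
  then show ?thesis
    unfolding LA_inv using nz by (intro exI[of _ x] conjI)
next
  case LB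
  have "rank_one_limit (\<lambda>n. letter_eval (A_seq n) (B_seq n) LB) 1 1 (col_vec y z LB) (row_vec y z LB)"
    by (rule rank_one_limit_affine[of _ 0 _ _ _ 0 0 "1 / z" 0 0 0 0]) (simp add: letter_seq del:
        letter_eval.simps)
  then show ?thesis
    unfolding LB by (intro exI[of _ 1] conjI one_neq_zero)
next
  case LB_inv
  have "rank_one_limit (\<lambda>n. letter_eval (A_seq n) (B_seq n) LB_inv) 1 1 (col_vec y z LB_inv)
      (row_vec y z LB_inv)"
    by (rule rank_one_limit_affine[of _ 0 _ _ _ 0 0 "- (1 / z)" 0 0 0 0], rule eventually_mono[OF
        eventually_gt_at_top[of 0]])
      (simp add: letter_seq del: letter_eval.simps)
  then show ?thesis
    unfolding LB_inv by (intro exI[of _ 1] conjI one_neq_zero)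
qed

text \<open>The quadratic terms cancel by orthogonality, but the linear coefficient is again rank
  one with the outer directions of the pair. Such a pair therefore behaves like a single
  letter.\<close>

lemma pair_limit:
  assumes "hot l" "\<not> hot m" "m \<noteq> inv_letter l"
  shows "\<exists>\<kappa>. \<kappa> \<noteq> 0 \<and> rank_one_limit (\<lambda>n. letter_eval (A_seq n) (B_seq n) l ** letter_eval (A_seq n)
      (B_seq n) m)
    1 \<kappa> (col_vec y z l) (row_vec y z m)"
proof -
  from assms consider "l = LA" "m = LB" | "l = LB_inv" "m = LA_inv"
    by (cases l; cases m) (auto simp: hot_def)
  then show ?thesis
  proof cases
    case 1
    have "rank_one_limit (\<lambda>n. letter_eval (A_seq n) (B_seq n) LA ** letter_eval (A_seq n) (B_seq n) LB)
      1 (- 1) (col_vec y z LA) (row_vec y z LB)"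
      by (rule rank_one_limit_affine[of _ 0 _ _ _ 0 "x / z" 0 0 0 0 "1 / z"], rule
          eventually_mono[OF eventually_gt_at_top[of 0]])
        (use nz in \<open>simp add: letter_seq mat2_mult del: letter_eval.simps\<close>)
    then show ?thesis
      unfolding 1 by (intro exI[of _ "- 1"] conjI) simp
  next
    case 2
    have "rank_one_limit (\<lambda>n. letter_eval (A_seq n) (B_seq n) LB_inv ** letter_eval (A_seq n) (B_seq
        n) LA_inv)
      1 1 (col_vec y z LB_inv) (row_vec y z LA_inv)"
      by (rule rank_one_limit_affine[of _ 0 _ _ _ "1 / z" "- (x / z)" 0 0 0 0 0], rule
          eventually_mono[OF eventually_gt_at_top[of 0]])
        (use nz in \<open>simp add: letter_seq mat2_mult del: letter_eval.simps\<close>)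
    then show ?thesis
      unfolding 2 by (intro exI[of _ 1] conjI one_neq_zero)
  qed
qed

lemma word_limit:
  assumes "freely_reduced w" "w \<noteq> []"
  shows "\<exists>\<kappa>. \<kappa> \<noteq> 0 \<and> rank_one_limit (\<lambda>n. word_eval (A_seq n) (B_seq n) w) (linear_degree w)
    \<kappa> (col_vec y z (hd w)) (row_vec y z (last w))"
  using assms
proof (induction w rule: length_induct)
  case (1 w)
  let ?L = "\<lambda>l n. letter_eval (A_seq n) (B_seq n) l"
  let ?W = "\<lambda>w n. word_eval (A_seq n) (B_seq n) w"
  \<comment> \<open>A hot-to-cold pair is split off as one block. Its second letter is cold, so the
    junction after the block is never hot-to-cold and \<open>pairing_nonzero\<close> applies
    there.\<close>
  consider (single) l where "w = [l]"
    | (rise) l m v where "w = l # m # v" "hot l \<longrightarrow> hot m"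
    | (fall_end) l m where "w = [l, m]" "hot l" "\<not> hot m"
    | (fall) l m m' v where "w = l # m # m' # v" "hot l" "\<not> hot m"
    using 1(3) by (metis list.exhaust)
  then show ?case
  proof cases
    case single
    then show ?thesis
      using letter_limit[of l] by simp
  next
    case rise
    then have red: "freely_reduced (m # v)" "m \<noteq> inv_letter l"
      using 1(2) by (auto simp: freely_reduced_def)
    obtain \<kappa> where k: "\<kappa> \<noteq> 0" "rank_one_limit (?L l) 1 \<kappa> (col_vec y z l) (row_vec y z l)"
      using letter_limit[of l] by blast
    obtain \<kappa>' where k': "\<kappa>' \<noteq> 0"
      "rank_one_limit (?W (m # v)) (linear_degree (m # v)) \<kappa>' (col_vec y z m) (row_vec y z (last (m
          # v)))"
      using 1(1)[rule_format, of "m # v"] red rise(1) by auto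
    have "\<kappa> * pairing (row_vec y z l) (col_vec y z m) * \<kappa>' \<noteq> 0"
      using k(1) k'(1) pairing_nonzero[OF nz(2,3) red(2) rise(2)] by simp
    moreover have "rank_one_limit (?W w) (linear_degree w) (\<kappa> * pairing (row_vec y z l) (col_vec y z
        m) * \<kappa>')
        (col_vec y z (hd w)) (row_vec y z (last w))"
      using rank_one_limit_mult[OF k(2) k'(2)] rise by simp
    ultimately show ?thesis by blast
  next
    case fall_end
    then have "m \<noteq> inv_letter l"
      using 1(2) by (auto simp: freely_reduced_def)
    then show ?thesis
      using pair_limit[of l m] fall_end by simp
  next
    case fall
    then have red: "freely_reduced (m' # v)" "m \<noteq> inv_letter l" "m' \<noteq> inv_letter m"
      using 1(2) by (auto simp: freely_reduced_def)
    obtain \<kappa> where k: "\<kappa> \<noteq> 0" "rank_one_limit (\<lambda>n. ?L l n ** ?L m n) 1 \<kappa> (col_vec y z l) (row_vec y z m)"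
      using pair_limit[OF fall(2,3) red(2)] by blast
    obtain \<kappa>' where k': "\<kappa>' \<noteq> 0" "rank_one_limit (?W (m' # v)) (linear_degree (m' # v)) \<kappa>' (col_vec
        y z m') (row_vec y z (last (m' # v)))"
      using 1(1)[rule_format, of "m' # v"] red fall by auto
    have "\<kappa> * pairing (row_vec y z m) (col_vec y z m') * \<kappa>' \<noteq> 0"
      using k(1) k'(1) pairing_nonzero[OF nz(2,3) red(3)] fall by simp
    moreover have "rank_one_limit (?W w) (linear_degree w) (\<kappa> * pairing (row_vec y z m) (col_vec y z
        m') * \<kappa>')
        (col_vec y z (hd w)) (row_vec y z (last w))"
      using rank_one_limit_mult[OF k(2) k'(2)] fall by (simp add: matrix_mul_assoc)
    ultimately show ?thesis by blast
  qed
qed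

lemma trace_limit:
  assumes "cyclically_reduced w" "w \<noteq> []" "hot (last w) \<longrightarrow> hot (hd w)"
  shows "\<exists>L. L \<noteq> 0 \<and> (\<lambda>n. eval3 (trace_poly w) (x * of_nat n) (y * of_nat n) (z * of_nat n + 1 / (z
      * of_nat n))
    / of_nat n ^ linear_degree w) \<longlonglongrightarrow> L"
proof -
  have red: "freely_reduced w" "hd w \<noteq> inv_letter (last w)"
    using assms by (auto simp: cyclically_reduced_def)
  obtain \<kappa> where k: "\<kappa> \<noteq> 0" "rank_one_limit (\<lambda>n. word_eval (A_seq n) (B_seq n) w) (linear_degree w)
      \<kappa> (col_vec y z (hd w)) (row_vec y z (last w))"
    using word_limit[OF red(1) assms(2)] by blast
  let ?L = "\<kappa> * pairing (row_vec y z (last w)) (col_vec y z (hd w))"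
  have "(\<lambda>n. eval3 (trace_poly w) (x * of_nat n) (y * of_nat n) (z * of_nat n + 1 / (z * of_nat n))
    / of_nat n ^ linear_degree w) \<longlonglongrightarrow> ?L"
  proof (rule Lim_transform_eventually[OF rank_one_limit_trace[OF k(2)]])
    show "\<forall>\<^sub>F n in sequentially. trace (word_eval (A_seq n) (B_seq n) w) / of_nat n ^ linear_degree w =
      eval3 (trace_poly w) (x * of_nat n) (y * of_nat n) (z * of_nat n + 1 / (z * of_nat n)) /
          of_nat n ^ linear_degree w"
      using eventually_gt_at_top[of 0]
    proof eventually_elim
      case (elim n)
      then have "z * of_nat n \<noteq> 0"
        using nz by simp
      from eval3_trace_poly[OF trace_A_SL2C trace_B_SL2C[OF this], of w] show ?case
        by (simp add: trace_A_B)
    qed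
  qed
  moreover have "?L \<noteq> 0"
    using k(1) pairing_nonzero[OF nz(2,3) red(2) assms(3)] by simp
  ultimately show ?thesis by blast
qed

end

text \<open>The direction from \<open>eval3_growth\<close> makes \<open>total_degree\<close> a
  growth exponent, and along the same sequence \<open>trace_limit\<close> gives
  \<open>linear_degree\<close>.\<close>

lemma total_degree_trace_poly_no_closing_fall:
  assumes "cyclically_reduced w" "w \<noteq> []" "hot (last w) \<longrightarrow> hot (hd w)"
  shows "total_degree (trace_poly w) = linear_degree w"
proof -
  have "trace_poly w \<noteq> 0"
  proof
    assume "trace_poly w = 0"
    then show False
      using trace_limit[of 1 1 1, OF _ _ _ assms] by (auto simp: LIMSEQ_const_iff)
  qed
  then obtain x y z L where xyz: "x \<noteq> 0" "y \<noteq> 0" "z \<noteq> 0" and L: "L \<noteq> 0"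
    "(\<lambda>n. eval3 (trace_poly w) (x * of_nat n) (y * of_nat n) (z * of_nat n + 1 / (z * of_nat n))
      / of_nat n ^ total_degree (trace_poly w)) \<longlonglongrightarrow> L"
    using eval3_growth by blast
  obtain M where M: "M \<noteq> 0"
    "(\<lambda>n. eval3 (trace_poly w) (x * of_nat n) (y * of_nat n) (z * of_nat n + 1 / (z * of_nat n))
      / of_nat n ^ linear_degree w) \<longlonglongrightarrow> M"
    using trace_limit[OF xyz assms] by blast
  show ?thesis
    by (rule growth_exponent_unique[OF L(2) M(2) L(1) M(1)])
qed

section \<open>From cyclically reduced to freely reduced words\<close>

lemma freely_reduced_append:
  "freely_reduced (u @ v) \<longleftrightarrow> freely_reduced u \<and> freely_reduced v \<and>
    (u \<noteq> [] \<longrightarrow> v \<noteq> [] \<longrightarrow> hd v \<noteq> inv_letter (last u))"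
  by (auto simp: freely_reduced_def successively_append_iff)

text \<open>If the closing junction is hot-to-cold, moving the last letter to the front makes it an
  interior junction. The new closing junction ends in a hot letter, so the previous case applies,
  with \<open>linear_degree\<close> lowered by one.\<close>

lemma total_degree_trace_poly:
  assumes "cyclically_reduced w" "w \<noteq> []"
  shows "total_degree (trace_poly w) + of_bool (hot (last w) \<and> \<not> hot (hd w)) = linear_degree w"
proof (cases "hot (last w) \<and> \<not> hot (hd w)")
  case True
  then have "butlast w \<noteq> []"
    using assms(2) by (cases w) auto
  then obtain m v l where w: "w = (m # v) @ [l]"
    using append_butlast_last_id[OF assms(2)] by (metis list.exhaust)
  define w' where "w' = l # m # v"
  have "hot l" "\<not> hot m"
    using True w by auto
  have red: "freely_reduced (m # v)" "l \<noteq> inv_letter (last (m # v))" "l \<noteq> inv_letter m"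
    using assms by (auto simp: w cyclically_reduced_def freely_reduced_append simp del: append_Cons)
  have "cyclically_reduced w'"
    unfolding cyclically_reduced_def w'_def
    using red freely_reduced_append[of "[l]" "m # v"] by (auto simp: freely_reduced_def)
  moreover have "hot (last w') \<longrightarrow> hot (hd w')"
    using \<open>hot l\<close> by (simp add: w'_def)
  moreover have "trace_poly w' = trace_poly w"
    using trace_poly_rotate[of "m # v" "[l]"] by (simp add: w w'_def)
  ultimately have "total_degree (trace_poly w) = linear_degree w'"
    using total_degree_trace_poly_no_closing_fall[of w'] by (simp add: w'_def)
  moreover have "linear_degree w = Suc (linear_degree w')"
    using linear_degree_snoc[of "m # v" l] \<open>hot l\<close> \<open>\<not> hot m\<close> by (simp add: w w'_def)
  ultimately show ?thesis
    using True by simp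
next
  case False
  then show ?thesis
    using total_degree_trace_poly_no_closing_fall[OF assms] by auto
qed

lemma cyclic_core:
  assumes "freely_reduced w" "w \<noteq> []"
  shows "\<exists>u c. w = u @ c @ rev (map inv_letter u) \<and> cyclically_reduced c \<and> c \<noteq> [] \<and>
    switches c \<le> switches w \<and> switches w \<le> switches c + 2 * length u"
  using assms
proof (induction w rule: length_induct)
  case (1 w)
  show ?case
  proof (cases "cyclically_reduced w")
    case True
    then show ?thesis
      using 1(3) by (intro exI[of _ "[]"] exI[of _ w]) simp
  next
    case False
    then have last: "last w = inv_letter (hd w)"
      using 1(2) by (simp add: cyclically_reduced_def)
    obtain l r where w: "w = l # r"
      using 1(3) by (cases w) auto
    have "r \<noteq> []"
      using last by (cases l) (auto simp: w)
    then obtain v where r: "r = v @ [inv_letter l]"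
      using last by (metis append_butlast_last_id last_ConsR list.sel(1) w)
    \<comment> \<open>\<open>v\<close> is nonempty because \<open>l\<close> followed by
      \<open>inv_letter l\<close> is not reduced.\<close>
    have "freely_reduced v" "v \<noteq> []"
      using 1(2) by (auto simp: w r freely_reduced_def successively_append_iff successively_Cons)
    then obtain u c where uc: "v = u @ c @ rev (map inv_letter u)" "cyclically_reduced c" "c \<noteq> []"
      "switches c \<le> switches v" "switches v \<le> switches c + 2 * length u"
      using 1(1)[rule_format, of v] by (auto simp: w r)
    have "switches v \<le> switches w" "switches w \<le> switches v + 2"
      using switches_Cons[where w = r and l = l] switches_snoc[where w = v and l = "inv_letter l"]
          by (auto simp: w r)
    then show ?thesis
      using uc by (intro exI[of _ "l # u"] exI[of _ c]) (auto simp: w r)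
  qed
qed

text \<open>Passing to the core changes twice the length by \<open>4 * length u\<close> and
  \<open>switches\<close> by at most \<open>2 * length u\<close>, with opposite effects on the sum;
  boundary and closing terms add at most \<open>1\<close>.\<close>

lemma total_degree_freely_reduced:
  assumes "freely_reduced w" "w \<noteq> []"
  obtains u c where "w = u @ c @ rev (map inv_letter u)"
    "\<bar>2 * real (total_degree (trace_poly w)) + real (switches w) - 2 * real (length w)\<bar> \<le> 4 * real
        (length u) + 1"
proof -
  obtain u c where uc: "w = u @ c @ rev (map inv_letter u)" "cyclically_reduced c" "c \<noteq> []"
    "switches c \<le> switches w" "switches w \<le> switches c + 2 * length u"
    using cyclic_core[OF assms] by blast
  have "trace_poly w = trace_poly c"
    unfolding uc(1) by (rule trace_poly_conjugate)
  moreover have "length w = length c + 2 * length u"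
    by (simp add: uc(1))
  ultimately have "\<bar>2 * real (total_degree (trace_poly w)) + real (switches w) - 2 * real (length
      w)\<bar> \<le> 4 * real (length u) + 1"
    using total_degree_trace_poly[OF uc(2,3)] linear_degree_switches[OF uc(3)] uc(4,5)
    by (auto simp: of_bool_def split: if_splits)
  with uc(1) show ?thesis ..
qed

section \<open>Random words\<close>

lemma UNIV_letter: "(UNIV :: letter set) = {LA, LA_inv, LB, LB_inv}"
  by (auto intro: letter.exhaust)

instance letter :: finite
  by standard (simp add: UNIV_letter)

lemma card_UNIV_letter [simp]: "card (UNIV :: letter set) = 4"
  by (simp add: UNIV_letter)

lemma pmf_map_Cons: "pmf (map_pmf ((#) m) M) w = (case w of [] \<Rightarrow> 0 | l # v \<Rightarrow> if l = m then pmf M v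
    else 0)"
proof (cases w)
  case Nil
  then have "w \<notin> (#) m ` set_pmf M"
    by auto
  then have "pmf (map_pmf ((#) m) M) w = 0"
    by (rule pmf_map_outside)
  then show ?thesis
    using Nil by simp
next
  case (Cons l v)
  show ?thesis
  proof (cases "l = m")
    case True
    then show ?thesis
      using Cons pmf_map_inj'[of "(#) m" M v] by simp
  next
    case False
    then have "w \<notin> (#) m ` set_pmf M"
      using Cons by auto
    then show ?thesis
      using Cons False by (simp add: pmf_map_outside)
  qed
qed

lemma pmf_nonbacktracking_from:
  "pmf (nonbacktracking_from l n) w = (if length w = n \<and> freely_reduced (l # w) then (1 / 3) ^ n else 0)"
proof (induction n arbitrary: l w)
  case 0
  then show ?case
    by (auto simp: freely_reduced_def)
next
  case (Suc n)
  have card: "card (UNIV - {inv_letter l}) = 3"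
    by (simp add: card_Diff_singleton)
  then have ne: "UNIV - {inv_letter l} \<noteq> {}"
    by force
  show ?case
  proof (cases w)
    case Nil
    then show ?thesis
      using ne by (simp add: pmf_bind integral_pmf_of_set pmf_map_Cons)
  next
    case (Cons m v)
    have "pmf (nonbacktracking_from l (Suc n)) w
        = (\<Sum>k\<in>UNIV - {inv_letter l}. if m = k then pmf (nonbacktracking_from k n) v else 0) / 3"
      using ne card Cons by (simp add: pmf_bind integral_pmf_of_set pmf_map_Cons)
    also have "\<dots> = (if m \<noteq> inv_letter l then pmf (nonbacktracking_from m n) v / 3 else 0)"
      by simp
    finally show ?thesis
      using Cons by (auto simp: Suc.IH freely_reduced_def)
  qed
qed

definition reduced_words :: "nat \<Rightarrow> word set" where
  "reduced_words n = {w. length w = n \<and> freely_reduced w}"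

lemma finite_words_length: "finite {w :: word. length w = n}"
  using finite_lists_length_eq[of "UNIV :: letter set" n] by simp

lemma finite_reduced_words [simp]: "finite (reduced_words n)"
  by (rule finite_subset[OF _ finite_words_length[of n]]) (auto simp: reduced_words_def)

lemma pmf_nonbacktracking_word:
  "pmf (nonbacktracking_word (Suc n)) w = (if w \<in> reduced_words (Suc n) then 1 / (4 * 3 ^ n) else 0)"
proof (cases w)
  case Nil
  then show ?thesis
    by (simp add: pmf_bind integral_pmf_of_set pmf_map_Cons reduced_words_def)
next
  case (Cons m v)
  have "pmf (nonbacktracking_word (Suc n)) w
      = (\<Sum>k\<in>UNIV. if m = k then pmf (nonbacktracking_from k n) v else 0) / 4"
    using Cons by (simp add: pmf_bind integral_pmf_of_set pmf_map_Cons)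
  also have "\<dots> = pmf (nonbacktracking_from m n) v / 4"
    by simp
  finally show ?thesis
    using Cons by (auto simp: pmf_nonbacktracking_from reduced_words_def power_divide)
qed

lemma prob_nonbacktracking_word:
  "measure_pmf.prob (nonbacktracking_word (Suc n)) S = real (card (S \<inter> reduced_words (Suc n))) / (4
      * 3 ^ n)"
proof -
  have "measure_pmf.prob (nonbacktracking_word (Suc n)) S
      = measure_pmf.prob (nonbacktracking_word (Suc n)) (S \<inter> reduced_words (Suc n))"
    by (rule measure_prob_cong_0) (auto simp del: nonbacktracking_word.simps simp:
        pmf_nonbacktracking_word)
  then show ?thesis
    by (simp del: nonbacktracking_word.simps add: measure_measure_pmf_finite pmf_nonbacktracking_word)
qed

text \<open>Read off from total mass \<open>1\<close>, all reduced words having equal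
  probability.\<close>

lemma card_reduced_words: "card (reduced_words (Suc n)) = 4 * 3 ^ n"
proof -
  have "real (card (reduced_words (Suc n))) = real (4 * 3 ^ n)"
    using prob_nonbacktracking_word[of n UNIV] by (simp del: nonbacktracking_word.simps)
  then show ?thesis
    by (simp only: of_nat_eq_iff)
qed

definition long_conjugator_words :: "nat \<Rightarrow> word set" where
  "long_conjugator_words k = {w. \<exists>u c. w = u @ c @ rev (map inv_letter u) \<and> k \<le> length u}"

text \<open>The last \<open>k\<close> letters of such a word are the inverse of its first
  \<open>k\<close>, so the word is recovered by \<open>?g\<close> from the prefix without them. The
  count drops from \<open>4 * 3 ^ n\<close> to at most \<open>4 * 3 ^ (n - k)\<close>.\<close>

lemma prob_long_conjugator:
  "measure_pmf.prob (nonbacktracking_word (Suc n)) (long_conjugator_words k) \<le> 1 / 3 ^ k"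
proof -
  let ?B = "long_conjugator_words k \<inter> reduced_words (Suc n)"
  let ?g = "\<lambda>v. v @ rev (map inv_letter (take k v))"
  have half: "2 * k \<le> Suc n \<and> ?g (take (Suc n - k) w) = w" if "w \<in> ?B" for w
  proof -
    from that obtain u c where w: "w = u @ c @ rev (map inv_letter u)" "k \<le> length u" "length w = Suc n"
      by (auto simp: long_conjugator_words_def reduced_words_def)
    define u1 u2 where "u1 = take k u" and "u2 = drop k u"
    have u: "u = u1 @ u2" "length u1 = k"
      using w(2) by (auto simp: u1_def u2_def)
    define v where "v = u1 @ u2 @ c @ rev (map inv_letter u2)"
    have wv: "w = v @ rev (map inv_letter u1)" and "take k v = u1"
      using w(1) u by (simp_all add: v_def)
    moreover have "Suc n - k = length v"
      using w(3) wv u(2) by simp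
    moreover have "2 * k \<le> Suc n"
      using w by simp
    ultimately show ?thesis
      by simp
  qed
  have *: "real (card ?B) * 3 ^ k \<le> 4 * 3 ^ n"
  proof (cases "?B = {}")
    case False
    then have "2 * k \<le> Suc n"
      using half by blast
    \<comment> \<open>\<open>2 * k \<le> Suc n\<close> gives \<open>k \<le> n\<close>, so the prefix
      has positive length and \<open>card_reduced_words\<close> applies.\<close>
    then obtain m where m: "Suc n - k = Suc m" "n = m + k"
      using that[of "n - k"] by linarith
    have "inj_on (take (Suc n - k)) ?B"
      by (rule inj_on_inverseI[of _ ?g]) (use half in blast)
    moreover have "take (Suc n - k) ` ?B \<subseteq> reduced_words (Suc m)"
    proof safe
      fix w assume "w \<in> reduced_words (Suc n)"
      then show "take (Suc n - k) w \<in> reduced_words (Suc m)"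
        using freely_reduced_append[of "take (Suc n - k) w" "drop (Suc n - k) w"] m
        by (simp add: reduced_words_def)
    qed
    ultimately have "card ?B \<le> 4 * 3 ^ m"
      using card_inj_on_le[OF _ _ finite_reduced_words] card_reduced_words by metis
    then have "real (card ?B) \<le> 4 * 3 ^ m"
      by (metis (mono_tags) of_nat_le_iff of_nat_mult of_nat_numeral of_nat_power)
    then show ?thesis
      by (simp add: m(2) power_add)
  qed simp
  then show ?thesis
    by (simp del: nonbacktracking_word.simps add: prob_nonbacktracking_word field_simps)
qed

text \<open>
  From every letter exactly one of the three admissible successors changes the class \<^const>\<open>hot\<close>,
  so the class changes are independent with probability \<open>1/3\<close>.
\<close>

lemma switch_bernoulli:
  "map_pmf (\<lambda>m. hot l \<noteq> hot m) (pmf_of_set (UNIV - {inv_letter l})) = bernoulli_pmf (1 / 3)"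
proof (rule pmf_eqI)
  fix b
  let ?S = "{m. m \<noteq> inv_letter l \<and> (hot l \<noteq> hot m) = b}"
  have card: "card (UNIV - {inv_letter l}) = 3"
    by (simp add: card_Diff_singleton)
  then have ne: "UNIV - {inv_letter l} \<noteq> {}"
    by force
  have "card ?S = (\<Sum>m\<in>UNIV. of_bool (m \<noteq> inv_letter l \<and> (hot l \<noteq> hot m) = b))"
    by simp
  also have "\<dots> = (if b then 1 else 2)"
    unfolding UNIV_letter by (cases l) (simp_all add: hot_def)
  finally have "card ?S = (if b then 1 else 2)" .
  then show "pmf (map_pmf (\<lambda>m. hot l \<noteq> hot m) (pmf_of_set (UNIV - {inv_letter l}))) b = pmf
      (bernoulli_pmf (1 / 3)) b"
    using ne card by (simp add: pmf_map measure_pmf_of_set vimage_def Int_def conj_commute)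
qed

text \<open>The law does not depend on the starting letter, so in the induction the first class
  change decouples from the rest.\<close>

lemma switches_binomial_from:
  "map_pmf (\<lambda>w. switches (l # w)) (nonbacktracking_from l n) = binomial_pmf n (1 / 3)"
proof (induction n arbitrary: l)
  case 0
  then show ?case
    by (simp add: binomial_pmf_0)
next
  case (Suc n)
  have "map_pmf (\<lambda>w. switches (l # w)) (nonbacktracking_from l (Suc n))
      = bind_pmf (pmf_of_set (UNIV - {inv_letter l}))
          (\<lambda>m. map_pmf (\<lambda>k. of_bool (hot l \<noteq> hot m) + k) (map_pmf (\<lambda>w. switches (m # w))
              (nonbacktracking_from m n)))"
    by (simp add: map_bind_pmf pmf.map_comp o_def)
  also have "\<dots> = bind_pmf (map_pmf (\<lambda>m. hot l \<noteq> hot m) (pmf_of_set (UNIV - {inv_letter l})))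
          (\<lambda>b. map_pmf (\<lambda>k. of_bool b + k) (binomial_pmf n (1 / 3)))"
    by (simp add: Suc.IH bind_map_pmf)
  also have "\<dots> = binomial_pmf (Suc n) (1 / 3)"
    unfolding switch_bernoulli by (simp add: binomial_pmf_Suc map_pmf_def of_bool_def)
  finally show ?case .
qed

lemma switches_binomial:
  "map_pmf switches (nonbacktracking_word (Suc n)) = binomial_pmf n (1 / 3)"
  by (simp add: map_bind_pmf pmf.map_comp o_def switches_binomial_from)

lemma prob_switches_deviation:
  assumes "n > 0" "\<epsilon> \<ge> 0"
  shows "measure_pmf.prob (nonbacktracking_word (Suc n)) {w. \<bar>real (switches w) - real n / 3\<bar> \<ge> \<epsilon>}
    \<le> 2 * exp (- 2 * \<epsilon>\<^sup>2 / real n)"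
proof -
  interpret binomial_distribution n "1 / 3"
    by standard simp
  have "measure_pmf.prob (nonbacktracking_word (Suc n)) {w. \<bar>real (switches w) - real n / 3\<bar> \<ge> \<epsilon>}
    = measure_pmf.prob (map_pmf switches (nonbacktracking_word (Suc n))) {x. \<bar>real x - real n * (1 /
        3)\<bar> \<ge> \<epsilon>}"
    by (simp add: vimage_def)
  also have "\<dots> \<le> 2 * exp (- 2 * \<epsilon>\<^sup>2 / real n)"
    unfolding switches_binomial using prob_abs_ge[OF assms] .
  finally show ?thesis .
qed

section \<open>Concentration of the degree\<close>

definition degree_deviation :: "real \<Rightarrow> nat \<Rightarrow> word set" where
  "degree_deviation C n = {w. \<not> \<bar>real (total_degree (trace_poly w)) - 5 * real n / 6\<bar> \<le> C * sqrt
      (real n * ln (real n))}"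

lemma prob_nonbacktracking_mono:
  assumes "S \<inter> reduced_words (Suc n) \<subseteq> T"
  shows "measure_pmf.prob (nonbacktracking_word (Suc n)) S \<le> measure_pmf.prob (nonbacktracking_word
      (Suc n)) T"
  unfolding prob_nonbacktracking_word
  using assms by (intro divide_right_mono of_nat_mono card_mono) auto

text \<open>The threshold is \<open>3 > e\<close>. These bounds absorb constants and the logarithmic
  conjugator length into the square-root term.\<close>

lemma ln_bounds:
  assumes "n \<ge> 3"
  shows "1 \<le> ln (real n)" "ln (real n) \<le> sqrt (real n * ln (real n))"
proof -
  have "exp 1 \<le> (3 :: real)"
    using e_less_272 by simp
  then have "exp 1 \<le> real n"
    using assms by linarith
  then show "1 \<le> ln (real n)"
    using assms by (subst ln_ge_iff) auto
  moreover have "ln (real n) \<le> real n"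
    using ln_le_minus_one[of "real n"] assms by simp
  ultimately have "ln (real n) * ln (real n) \<le> real n * ln (real n)"
    by (intro mult_right_mono) auto
  then show "ln (real n) \<le> sqrt (real n * ln (real n))"
    by (intro real_le_rsqrt) (simp add: power2_eq_square)
qed

lemma prob_degree_deviation:
  assumes "D > 0" "n \<ge> 3"
  shows "measure_pmf.prob (nonbacktracking_word n) (degree_deviation (2 * D + 1 + sqrt D) n) \<le> 3 *
      real n powr (- D)"
proof -
  obtain m where m: "n = Suc m" "m > 0"
    using assms(2) by (cases n) auto
  \<comment> \<open>Chosen so that
    \<open>1 / 3 ^ k \<le> exp (- real k) \<le> real n powr (- D)\<close>.\<close>
  define k where "k = nat \<lceil>D * ln (real n)\<rceil>"
  define r where "r = sqrt (real n * ln (real n))"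
  \<comment> \<open>Then \<epsilon>^2 = \<open>D * (real n * ln (real n))\<close>, which brings
    Hoeffding's exponential below \<open>real n powr (- D)\<close>.\<close>
  define \<epsilon> where "\<epsilon> = sqrt D * r"
  let ?Dev = "{w. \<bar>real (switches w) - real m / 3\<bar> \<ge> \<epsilon>}"
  let ?P = "measure_pmf.prob (nonbacktracking_word (Suc m))"
  have ln1: "1 \<le> ln (real n)" and lnr: "ln (real n) \<le> r"
    using ln_bounds[OF assms(2)] by (simp_all add: r_def)
  have k: "D * ln (real n) \<le> real k" "real k < D * ln (real n) + 1"
    using ln1 assms(1) by (auto simp: k_def) linarith
  have powr: "real n powr (- D) = exp (- (D * ln (real n)))"
    using assms(2) by (simp add: powr_def)
  have "degree_deviation (2 * D + 1 + sqrt D) n \<inter> reduced_words (Suc m) \<subseteq> ?Dev \<union> long_conjugator_words k"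
  proof (rule subsetI, rule ccontr)
    fix w assume w: "w \<in> degree_deviation (2 * D + 1 + sqrt D) n \<inter> reduced_words (Suc m)"
      and nw: "w \<notin> ?Dev \<union> long_conjugator_words k"
    then have "freely_reduced w" "w \<noteq> []" and len: "length w = n"
      by (auto simp: reduced_words_def m(1))
    then obtain u c where uc: "w = u @ c @ rev (map inv_letter u)"
      and deg: "\<bar>2 * real (total_degree (trace_poly w)) + real (switches w) - 2 * real n\<bar> \<le> 4 * real
          (length u) + 1"
      by (metis total_degree_freely_reduced)
    have "length u < k"
      using nw uc by (auto simp: long_conjugator_words_def not_le)
    \<comment> \<open>\<open>length u\<close> is at most \<open>k - 1\<close>, which undoes the
      rounding up in \<open>k\<close>.\<close>
    then have u: "real (length u) \<le> D * ln (real n)"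
      using k(2) by linarith
    have sw: "\<bar>real (switches w) - real m / 3\<bar> < \<epsilon>"
      using nw by simp
    have n: "real n = real m + 1"
      by (simp add: m(1))
    \<comment> \<open>The degree is n - switches/2 up to \<open>2 * length u + 1/2\<close>, and
      switches/2 is (n - 1)/6 up to \<epsilon>/2; hence the centre 5n/6, with 1/2 + 1/6 rounded up
      to \<open>1\<close>.\<close>
    have "\<bar>real (total_degree (trace_poly w)) - 5 * real n / 6\<bar> \<le> 2 * (D * ln (real n)) + 1 + \<epsilon>"
      using deg u sw n unfolding abs_le_iff abs_less_iff by linarith
    also have "\<dots> \<le> 2 * (D * r) + r + \<epsilon>"
      using ln1 lnr assms(1) by (intro add_mono mult_left_mono) auto
    also have "\<dots> = (2 * D + 1 + sqrt D) * r"
      by (simp add: \<epsilon>_def algebra_simps)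
    finally show False
      using w by (simp add: degree_deviation_def r_def)
  qed
  then have "?P (degree_deviation (2 * D + 1 + sqrt D) n) \<le> ?P (?Dev \<union> long_conjugator_words k)"
    by (rule prob_nonbacktracking_mono)
  also have "\<dots> \<le> ?P ?Dev + ?P (long_conjugator_words k)"
    by (rule measure_Un_le) auto
  also have "\<dots> \<le> 2 * real n powr (- D) + real n powr (- D)"
  proof (rule add_mono)
    have "\<epsilon>\<^sup>2 = D * (real n * ln (real n))"
      using assms(1) ln1 by (simp add: \<epsilon>_def r_def power_mult_distrib)
    moreover have "D * (real m * ln (real n)) \<le> D * (real n * ln (real n))"
      using assms(1) ln1 m by (intro mult_left_mono mult_right_mono) auto
    moreover have "0 \<le> D * (real n * ln (real n))"
      using assms(1) ln1 by simp
    ultimately have "D * ln (real n) * real m \<le> 2 * \<epsilon>\<^sup>2"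
      by (simp add: mult.commute mult.left_commute)
    then have "D * ln (real n) \<le> 2 * \<epsilon>\<^sup>2 / real m"
      using m(2) by (simp add: pos_le_divide_eq)
    then have "exp (- 2 * \<epsilon>\<^sup>2 / real m) \<le> real n powr (- D)"
      by (simp add: powr)
    moreover have "0 \<le> \<epsilon>"
      using assms(1) ln1 lnr by (simp add: \<epsilon>_def)
    ultimately show "?P ?Dev \<le> 2 * real n powr (- D)"
      using prob_switches_deviation[OF m(2), of \<epsilon>] by linarith
    have "exp (real k) \<le> 3 ^ k"
      using power_mono[of "exp 1" "3 :: real" k] e_less_272 by (simp add: exp_of_nat_mult[symmetric])
    then have "1 / 3 ^ k \<le> exp (- real k)"
      by (simp add: exp_minus field_simps)
    also have "\<dots> \<le> real n powr (- D)"
      using k(1) by (simp add: powr)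
    finally show "?P (long_conjugator_words k) \<le> real n powr (- D)"
      using prob_long_conjugator[of m k] by linarith
  qed
  finally show ?thesis
    by (simp add: m(1) del: nonbacktracking_word.simps)
qed

text \<open>At most two of the four letters are forbidden as an appended closing letter, so every
  reduced word extends injectively.\<close>

lemma card_cyclically_reduced_ge:
  assumes "n > 0"
  shows "card (reduced_words n) \<le> card {w. length w = Suc n \<and> cyclically_reduced w}"
proof -
  have "\<exists>l. l \<noteq> inv_letter (last w) \<and> l \<noteq> inv_letter (hd w)" for w
    by (cases "last w"; cases "hd w") auto
  then obtain f where f: "\<And>w. f w \<noteq> inv_letter (last w) \<and> f w \<noteq> inv_letter (hd w)"
    by metis
  show ?thesis
  proof (rule card_inj_on_le)
    show "inj_on (\<lambda>w. w @ [f w]) (reduced_words n)"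
      by (auto simp: inj_on_def)
    show "(\<lambda>w. w @ [f w]) ` reduced_words n \<subseteq> {w. length w = Suc n \<and> cyclically_reduced w}"
      using f assms by (auto simp: reduced_words_def cyclically_reduced_def freely_reduced_append)
        (auto simp: freely_reduced_def)
    show "finite {w. length w = Suc n \<and> cyclically_reduced w}"
      by (rule finite_subset[OF _ finite_words_length[of "Suc n"]]) auto
  qed
qed

text \<open>At least \<open>4 * 3 ^ (n - 2)\<close> of the \<open>4 * 3 ^ (n - 1)\<close> reduced
  words are cyclically reduced, a proportion of at least 1/3.\<close>

lemma prob_uniform_cyclically_reduced_le:
  assumes "n \<ge> 2"
  shows "measure_pmf.prob (uniform_cyclically_reduced n) S \<le> 3 * measure_pmf.prob
      (nonbacktracking_word n) S"
proof -
  obtain m where m: "n = Suc (Suc m)"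
    using assms by (metis add_2_eq_Suc le_Suc_ex)
  let ?C = "{w. length w = n \<and> cyclically_reduced w}"
  have fin: "finite ?C"
    by (rule finite_subset[OF _ finite_words_length[of n]]) auto
  have "4 * 3 ^ m \<le> card ?C"
    using card_cyclically_reduced_ge[of "Suc m"] by (simp add: card_reduced_words m)
  then have ge: "4 * 3 ^ m \<le> real (card ?C)"
    by (metis (mono_tags) of_nat_le_iff of_nat_mult of_nat_numeral of_nat_power)
  then have "0 < real (card ?C)"
    by (rule less_le_trans[rotated]) simp
  then have ne: "?C \<noteq> {}"
    by (intro notI) (simp only: card.empty of_nat_0 less_irrefl)
  have "card (?C \<inter> S) \<le> card (S \<inter> reduced_words n)"
    by (rule card_mono) (auto simp: reduced_words_def[of n] cyclically_reduced_def intro: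
        finite_subset[OF _ finite_words_length[of n]])
  then have "real (card (?C \<inter> S)) / real (card ?C) \<le> real (card (S \<inter> reduced_words n)) / (4 * 3 ^ m)"
    using ge by (intro frac_le) auto
  then show ?thesis
    using fin ne unfolding uniform_cyclically_reduced_def m
    by (simp add: measure_pmf_of_set prob_nonbacktracking_word del: nonbacktracking_word.simps)
qed

theorem theorem1p3:
  fixes D :: real
  assumes "D > 0"
  shows "(\<exists>C>0. \<exists>C'>0. \<forall>\<^sub>F n in sequentially.
            measure_pmf.prob (nonbacktracking_word n)
              {w. \<bar>real (total_degree (trace_poly w)) - 5 * real n / 6\<bar>
                    \<le> C * sqrt (real n * ln (real n))}
            \<ge> 1 - C' * real n powr (- D))
       \<and> (\<exists>C>0. \<exists>C'>0. \<forall>\<^sub>F n in sequentially.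
            measure_pmf.prob (uniform_cyclically_reduced n)
              {w. \<bar>real (total_degree (trace_poly w)) - 5 * real n / 6\<bar>
                    \<le> C * sqrt (real n * ln (real n))}
            \<ge> 1 - C' * real n powr (- D))"
proof -
  define C where "C = 2 * D + 1 + sqrt D"
  have "C > 0"
    using assms by (simp add: C_def add_pos_nonneg)
  have compl: "measure_pmf.prob M {w. \<bar>real (total_degree (trace_poly w)) - 5 * real n / 6\<bar>
      \<le> C * sqrt (real n * ln (real n))} = 1 - measure_pmf.prob M (degree_deviation C n)" for M n
    using measure_pmf.prob_compl[of "degree_deviation C n" M]
    by (simp add: degree_deviation_def Compl_eq_Diff_UNIV[symmetric] Collect_neg_eq[symmetric])
  have "\<forall>\<^sub>F n in sequentially. measure_pmf.prob (nonbacktracking_word n) (degree_deviation C n) \<le> 3 * real n powr (- D)"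
    using eventually_ge_at_top[of 3] by eventually_elim (use prob_degree_deviation[OF assms] in \<open>simp add: C_def\<close>)
  \<comment> \<open>The constant \<open>9\<close> is the \<open>3\<close> of the deviation bound
    times the \<open>3\<close> from the proportion of cyclically reduced words.\<close>
  moreover have "\<forall>\<^sub>F n in sequentially. measure_pmf.prob (uniform_cyclically_reduced n) (degree_deviation C n) \<le> 9 * real n powr (- D)"
    using eventually_ge_at_top[of 3]
  proof eventually_elim
    case (elim n)
    then show ?case
      using prob_uniform_cyclically_reduced_le[of n "degree_deviation C n"] prob_degree_deviation[OF assms, of n]
      by (simp add: C_def)
  qed
  ultimately show ?thesis
    using \<open>C > 0\<close>
    by (intro conjI exI[of _ C] exI[of _ 3] exI[of _ 9]) (simp_all add: compl)
qed

end
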